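(* Let $\beta\in[0,1)$ and let $U:\mathbb{R}^d\to\mathbb{R}$ satisfy: (i) $U$ is twice continuously differentiable, $\nabla U(0)=0$, and $\sup_x\|\mathrm{D}^2U(x)\|\le\mathtt{L}$ for some $\mathtt{L}\ge0$; (ii) there exist $\mathtt{m}_\beta>0$ and $\mathtt{L}_\beta,\mathtt{K}_\beta\ge0$ such that for all $x,y\in\mathbb{R}^d$ with $\|x\|\ge\mathtt{K}_\beta$ and $\|y\|=1$, $$\frac{\mathtt{L}_\beta}{1+\|x\|^{3\beta/4}}\ge \mathrm{D}^2U(x)[y,y]\ge\frac{\mathtt{m}_\beta}{1+\|x\|^\beta}.$$ Let $\bar\eta_\beta=\mathtt{m}_\beta/2^5$ and $W_{\bar\eta_\beta}(x)=\exp\{\bar\eta_\beta(1+\|x\|^2)^{1/2}\}$. Then there exists $\Gamma_\beta>0$ such that for every $\gamma\in(0,\Gamma_\beta]$ there exist $C_{\gamma,\beta}\ge0$ and $\rho_{\gamma,\beta}\in[0,1)$ such that for all $x\in\mathbb{R}^d$ and $k\in\mathbb{N}$, $$\|\delta_xR_\gamma^k-\pi\|_{W_{\bar\eta_\beta}}\le C_{\gamma,\beta}\rho_{\gamma,\beta}^kW_{\bar\eta_\beta}(x).$$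
   Context: $\pi$ denotes the probability density proportional to $e^{-U}$ and the associated measure. For $\gamma>0$, $r_\gamma(x,y)=(4\pi\gamma)^{-d/2}\exp(-\|y-x+\gamma\nabla U(x)\|^2/(4\gamma))$, $\alpha_\gamma(x,y)=1\wedge\frac{\pi(y)r_\gamma(y,x)}{\pi(x)r_\gamma(x,y)}$, and the MALA kernel is $R_\gamma(x,A)=\int\mathbb{1}_A(y)\alpha_\gamma(x,y)r_\gamma(x,y)dy+\delta_x(A)\int\{1-\alpha_\gamma(x,y)\}r_\gamma(x,y)dy$. For $V\ge1$ measurable and a finite signed measure $\mu$, $\|\mu\|_V=\sup\{|\int fd\mu|:\sup_x|f(x)|/V(x)\le1\}$. *)

theory Defs
  imports "HOL-Probability.Probability"
begin

text \<open>Real power with the convention t^0 = 1 (also at t = 0).\<close>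
definition rpow :: "real \<Rightarrow> real \<Rightarrow> real" where
  "rpow t a = (if a = 0 then 1 else t powr a)"

definition norm_const :: "('a::euclidean_space \<Rightarrow> real) \<Rightarrow> real" where
  "norm_const U = (\<integral>x. exp (- U x) \<partial>lborel)"

definition pi_dens :: "('a::euclidean_space \<Rightarrow> real) \<Rightarrow> 'a \<Rightarrow> real" where
  "pi_dens U x = exp (- U x) / norm_const U"

definition pi_meas :: "('a::euclidean_space \<Rightarrow> real) \<Rightarrow> 'a measure" where
  "pi_meas U = density lborel (\<lambda>x. ennreal (pi_dens U x))"

text \<open>Proposal density r_gamma(x,y); gU is the gradient of U.\<close>
definition prop_dens :: "('a::euclidean_space \<Rightarrow> 'a) \<Rightarrow> real \<Rightarrow> 'a \<Rightarrow> 'a \<Rightarrow> real" where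
  "prop_dens gU \<gamma> x y =
     (4 * pi * \<gamma>) powr (- real DIM('a) / 2) *
     exp (- (norm (y - x + \<gamma> *\<^sub>R gU x))\<^sup>2 / (4 * \<gamma>))"

definition accept :: "('a::euclidean_space \<Rightarrow> real) \<Rightarrow> ('a \<Rightarrow> 'a) \<Rightarrow> real \<Rightarrow> 'a \<Rightarrow> 'a \<Rightarrow> real" where
  "accept U gU \<gamma> x y =
     min 1 ((pi_dens U y * prop_dens gU \<gamma> y x) / (pi_dens U x * prop_dens gU \<gamma> x y))"

definition MALA :: "('a::euclidean_space \<Rightarrow> real) \<Rightarrow> ('a \<Rightarrow> 'a) \<Rightarrow> real \<Rightarrow> 'a \<Rightarrow> 'a measure" where
  "MALA U gU \<gamma> x = measure_of UNIV (sets borel)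
     (\<lambda>A. (\<integral>\<^sup>+ y. indicator A y * ennreal (accept U gU \<gamma> x y * prop_dens gU \<gamma> x y) \<partial>lborel)
        + indicator A x * (\<integral>\<^sup>+ y. ennreal ((1 - accept U gU \<gamma> x y) * prop_dens gU \<gamma> x y) \<partial>lborel))"

fun MALA_iter :: "('a::euclidean_space \<Rightarrow> real) \<Rightarrow> ('a \<Rightarrow> 'a) \<Rightarrow> real \<Rightarrow> nat \<Rightarrow> 'a \<Rightarrow> 'a measure" where
  "MALA_iter U gU \<gamma> 0 x = return borel x"
| "MALA_iter U gU \<gamma> (Suc k) x = bind (MALA_iter U gU \<gamma> k x) (MALA U gU \<gamma>)"

text \<open>V-norm of the signed measure M - N: supremum of |int f dM - int f dN| over measurable f
  with |f| <= V (restricted to f integrable w.r.t. both, which gives the same supremum, possibly infinity).\<close>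
definition Vnorm :: "'a::euclidean_space measure \<Rightarrow> 'a measure \<Rightarrow> ('a \<Rightarrow> real) \<Rightarrow> ereal" where
  "Vnorm M N V = (SUP f \<in> {f. f \<in> borel_measurable borel \<and> (\<forall>x. \<bar>f x\<bar> \<le> V x)
                            \<and> integrable M f \<and> integrable N f}.
                   ereal \<bar>(\<integral>x. f x \<partial>M) - (\<integral>x. f x \<partial>N)\<bar>)"

end

theory Submission
  imports Defs "HOL-Real_Asymp.Real_Asymp"
begin

text \<open>
  The theorem follows from Harris' theorem: a geometric drift condition for \<open>W\<close>, a minorization on
  the level sets of \<open>W\<close> (the accepted part of the kernel has a positive continuous density), and
  invariance of \<open>\<pi>\<close> by detailed balance.

  For the drift, \<open>\<beta> < 1\<close> and tail convexity give \<open>\<parallel>x\<parallel> - \<parallel>x - \<gamma> \<nabla>U(x)\<parallel> \<rightarrow> \<infinity>\<close>, so the proposal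
  satisfies \<open>\<integral> W(y) r\<^sub>\<gamma>(x,y) dy = o(W(x))\<close>; it remains to bound the acceptance probability from
  below for large \<open>x\<close>. With \<open>h = y - x\<close>, \<open>w = h + \<gamma> \<nabla>U(x)\<close> and \<open>D = \<nabla>U(y) - \<nabla>U(x)\<close>, the logarithm
  of the acceptance ratio is
  \<open>U(x) - U(y) + \<langle>\<nabla>U(y), h\<rangle> - \<langle>w, D\<rangle> / 2 - \<gamma> \<parallel>D\<parallel>\<^sup>2 / 4\<close>.
  The Taylor remainder is at least of order \<open>\<parallel>x\<parallel>\<^sup>-\<^sup>\<beta> \<parallel>h\<parallel>\<^sup>2\<close>, while \<open>\<parallel>D\<parallel>\<^sup>2\<close> is at most of order
  \<open>\<parallel>x\<parallel>\<^sup>-\<^sup>3\<^sup>\<beta>\<^sup>/\<^sup>2 \<parallel>h\<parallel>\<^sup>2\<close>; hence on the event \<open>\<parallel>w\<parallel>\<^sup>2 \<le> 2 \<gamma>\<close> the ratio is at least \<open>exp (-1/2)\<close> for small \<open>\<gamma>\<close>.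
\<close>

section \<open>Potentials with convex tails\<close>

text \<open>The form of \<open>A\<close> is nonnegative at \<open>v - s *\<^sub>R A v\<close> for
  every real \<open>s\<close>; bounding the resulting quadratic in \<open>s\<close> and taking its
  minimiser \<open>1 / M\<close> gives the claim. This turns bounds on the quadratic form, which is
  all the tail hypothesis controls, into bounds on the vector \<open>A v\<close>.\<close>

lemma norm_psd_le:
  fixes A :: "'a::real_inner \<Rightarrow>\<^sub>L 'a"
  assumes sym: "\<And>v w. A v \<bullet> w = A w \<bullet> v"
    and psd: "\<And>v. 0 \<le> A v \<bullet> v" and ub: "\<And>v. A v \<bullet> v \<le> M * (norm v)\<^sup>2" and M: "0 \<le> M"
  shows "(norm (A v))\<^sup>2 \<le> M * (A v \<bullet> v)"
proof -
  define w where "w = A v"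
  have quad: "0 \<le> A v \<bullet> v - 2 * s * (norm w)\<^sup>2 + s\<^sup>2 * (M * (norm w)\<^sup>2)" for s
  proof -
    have "0 \<le> A (v - s *\<^sub>R w) \<bullet> (v - s *\<^sub>R w)" by (rule psd)
    also have "\<dots> = A v \<bullet> v - 2 * s * (norm w)\<^sup>2 + s\<^sup>2 * (A w \<bullet> w)"
      using sym[of w v]
      by (simp add: blinfun.bilinear_simps inner_simps w_def power2_norm_eq_inner algebra_simps power2_eq_square[of s])
    also have "\<dots> \<le> A v \<bullet> v - 2 * s * (norm w)\<^sup>2 + s\<^sup>2 * (M * (norm w)\<^sup>2)"
      using ub[of w] by (simp add: mult_left_mono)
    finally show ?thesis .
  qed
  show ?thesis
  \<comment> \<open>For \<open>M = 0\<close> the form vanishes at \<open>v\<close>, the quadratic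
    degenerates to a linear function of \<open>s\<close>, and \<open>s = 1\<close> forces
    \<open>w = 0\<close>.\<close>
  proof (cases "M = 0")
    case True
    then have "A v \<bullet> v = 0" using ub[of v] psd[of v] by simp
    then show ?thesis using quad[of 1] True by (simp add: w_def)
  next
    case False
    then have "M > 0" using M by simp
    then show ?thesis using quad[of "1 / M"]
      by (simp add: w_def field_simps power2_eq_square)
  qed
qed

lemma rpow_mono: "0 \<le> s \<Longrightarrow> s \<le> t \<Longrightarrow> 0 \<le> a \<Longrightarrow> rpow s a \<le> rpow t a"
  by (auto simp: rpow_def powr_mono2)

lemma rpow_nonneg: "0 \<le> rpow t a"
  by (simp add: rpow_def)

text \<open>This is where \<beta> < 1 enters: curvature of order r^(-\<beta>) accumulated over a
  length of order r grows like r^(1-\<beta>), hence beyond any \<open>B\<close>.\<close>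

lemma rpow_growth:
  fixes B K \<beta> m :: real
  assumes "\<beta> < 1" "0 \<le> \<beta>" "m > 0"
  shows "\<exists>R>0. \<forall>r\<ge>R. B \<le> m * (r - K) / (2 * (1 + rpow r \<beta>))"
proof -
  \<comment> \<open>For r \<ge> 1 and r \<ge> 2K the numerator is at least m r / 2 and the
    denominator at most 4 r^\<beta>, whence the factor 1/8.\<close>
  have "filterlim (\<lambda>r::real. m / 8 * r powr (1 - \<beta>)) at_top at_top"
    using assms by real_asymp
  then have "eventually (\<lambda>r. B \<le> m / 8 * r powr (1 - \<beta>)) at_top"
    by (simp add: filterlim_at_top)
  then obtain R0 where R0: "\<And>r. r \<ge> R0 \<Longrightarrow> B \<le> m / 8 * r powr (1 - \<beta>)"
    by (auto simp: eventually_at_top_linorder)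
  define R where "R = Max {R0, 1, 2 * K}"
  have "B \<le> m * (r - K) / (2 * (1 + rpow r \<beta>))" if "r \<ge> R" for r
  proof -
    have r: "r \<ge> R0" "r \<ge> 1" "r \<ge> 2 * K" using that by (auto simp: R_def)
    have rp: "rpow r \<beta> = r powr \<beta>" using r by (simp add: rpow_def)
    have ge1: "1 \<le> r powr \<beta>" using r assms by (simp add: ge_one_powr_ge_zero)
    have eq: "r powr (1 - \<beta>) * r powr \<beta> = r" using r by (simp add: powr_add[symmetric])
    have "m / 8 * r powr (1 - \<beta>) * (2 * (1 + r powr \<beta>)) \<le> m / 8 * r powr (1 - \<beta>) * (4 * r powr \<beta>)"
      using ge1 assms by (intro mult_left_mono) auto
    also have "\<dots> = m * (r / 2)" using eq by (simp add: field_simps)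
    also have "\<dots> \<le> m * (r - K)" using r assms by (intro mult_left_mono) auto
    finally have "m / 8 * r powr (1 - \<beta>) \<le> m * (r - K) / (2 * (1 + rpow r \<beta>))"
      using ge1 by (simp add: rp pos_le_divide_eq)
    then show ?thesis using R0[OF r(1)] by linarith
  qed
  moreover have "R > 0" by (simp add: R_def)
  ultimately show ?thesis by blast
qed

lemma line_bound:
  fixes f :: "real \<Rightarrow> 'b::real_inner"
  assumes "\<And>t. (f has_vector_derivative f' t) (at t)"
    and "\<And>t. 0 < t \<Longrightarrow> t < 1 \<Longrightarrow> norm (f' t) \<le> B"
  shows "norm (f 1 - f 0) \<le> B"
proof -
  have "\<exists>x\<in>{0<..<1}. norm (f 1 - f 0) \<le> norm ((1 - 0) *\<^sub>R f' x)"
    using assms(1)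
    by (intro mvt_general continuous_at_imp_continuous_on ballI)
       (auto simp: has_vector_derivative_def intro: has_vector_derivative_continuous assms(1))
  then show ?thesis using assms(2) by (auto intro: order_trans)
qed

text \<open>The point is that the trapezoidal error of \<open>U\<close>, which has no sign, combines with the drift into
  the Taylor remainder at \<open>y\<close>, which is nonnegative by convexity.\<close>

lemma log_ratio_decomposition:
  fixes x y g g' :: "'a::real_inner"
  assumes "\<gamma> > 0"
  defines "w \<equiv> y - x + \<gamma> *\<^sub>R g" and "D \<equiv> g' - g"
  shows "u - u' + ((norm w)\<^sup>2 - (norm (x - y + \<gamma> *\<^sub>R g'))\<^sup>2) / (4 * \<gamma>)
    = (u - u' + g' \<bullet> (y - x)) - w \<bullet> D / 2 - \<gamma> / 4 * (norm D)\<^sup>2"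
proof -
  have "(norm w)\<^sup>2 - (norm (x - y + \<gamma> *\<^sub>R g'))\<^sup>2 = 4 * \<gamma> * (g' \<bullet> (y - x) - w \<bullet> D / 2 - \<gamma> / 4 * (norm D)\<^sup>2)"
    unfolding power2_norm_eq_inner w_def D_def
    by (simp add: inner_simps inner_commute field_simps)
  then show ?thesis using assms by (simp add: field_simps)
qed

section \<open>Twice differentiable potentials: calculus along lines and symmetry of the
  Hessian\<close>

locale C2_potential =
  fixes U :: "'a::euclidean_space \<Rightarrow> real" and gU :: "'a \<Rightarrow> 'a" and HU :: "'a \<Rightarrow> ('a \<Rightarrow>\<^sub>L 'a)"
  assumes grad: "\<And>x. (U has_derivative (\<lambda>h. gU x \<bullet> h)) (at x)"
    and hess: "\<And>x. (gU has_derivative blinfun_apply (HU x)) (at x)"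
    and hess_cont: "continuous_on UNIV HU"
begin

lemma U_line_deriv: "((\<lambda>t. U (x + t *\<^sub>R h)) has_real_derivative (gU (x + t *\<^sub>R h) \<bullet> h)) (at t)"
proof -
  have "((\<lambda>t. U (x + t *\<^sub>R h)) has_derivative (\<lambda>s. gU (x + t *\<^sub>R h) \<bullet> (s *\<^sub>R h))) (at t)"
    by (rule has_derivative_compose[OF _ grad]) (auto intro!: derivative_eq_intros)
  then show ?thesis by (simp add: has_field_derivative_def mult_commute_abs)
qed

lemma gU_line_deriv: "((\<lambda>t. gU (x + t *\<^sub>R h)) has_vector_derivative (HU (x + t *\<^sub>R h) h)) (at t)"
proof -
  have "((\<lambda>t. gU (x + t *\<^sub>R h)) has_derivative (\<lambda>s. HU (x + t *\<^sub>R h) (s *\<^sub>R h))) (at t)"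
    by (rule has_derivative_compose[OF _ hess]) (auto intro!: derivative_eq_intros)
  then show ?thesis by (simp add: has_vector_derivative_def blinfun.scaleR_right)
qed

lemma gU_line_inner_deriv:
  "((\<lambda>t. gU (x + t *\<^sub>R h) \<bullet> k) has_real_derivative (HU (x + t *\<^sub>R h) h \<bullet> k)) (at t)"
  using has_derivative_inner_left[OF gU_line_deriv[unfolded has_vector_derivative_def], of x h k t]
  by (simp add: has_field_derivative_def mult_commute_abs)

lemma U_continuous: "continuous_on S U"
  by (meson continuous_at_imp_continuous_on grad has_derivative_continuous)

lemma gU_continuous: "continuous_on S gU"
  by (meson continuous_at_imp_continuous_on hess has_derivative_continuous)

text \<open>Two mean value theorems: first in direction \<open>h\<close> for the difference
  \<open>\<psi>\<close>, then in direction \<open>k\<close> for the gradient. The left-hand side is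
  symmetric in \<open>h\<close> and \<open>k\<close>, which is what yields the symmetry of the
  Hessian.\<close>

lemma mixed_difference:
  "\<exists>\<xi>. norm (\<xi> - x) \<le> norm h + norm k \<and> U (x + h + k) - U (x + h) - U (x + k) + U x = HU \<xi> k \<bullet> h"
proof -
  define \<psi> where "\<psi> s = U ((x + k) + s *\<^sub>R h) - U (x + s *\<^sub>R h)" for s
  have "(\<psi> has_real_derivative (gU ((x + k) + s *\<^sub>R h) \<bullet> h - gU (x + s *\<^sub>R h) \<bullet> h)) (at s)" for s
    unfolding \<psi>_def by (intro DERIV_diff U_line_deriv)
  then obtain s where s: "0 < s" "s < 1"
      "\<psi> 1 - \<psi> 0 = (1 - 0) * (gU ((x + k) + s *\<^sub>R h) \<bullet> h - gU (x + s *\<^sub>R h) \<bullet> h)"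
    using MVT2[of 0 1 \<psi> "\<lambda>s. gU ((x + k) + s *\<^sub>R h) \<bullet> h - gU (x + s *\<^sub>R h) \<bullet> h"] by auto
  obtain t where t: "0 < t" "t < 1" "gU ((x + s *\<^sub>R h) + 1 *\<^sub>R k) \<bullet> h - gU ((x + s *\<^sub>R h) + 0 *\<^sub>R k) \<bullet> h
      = (1 - 0) * (HU ((x + s *\<^sub>R h) + t *\<^sub>R k) k \<bullet> h)"
    using MVT2[of 0 1 "\<lambda>t. gU ((x + s *\<^sub>R h) + t *\<^sub>R k) \<bullet> h" "\<lambda>t. HU ((x + s *\<^sub>R h) + t *\<^sub>R k) k \<bullet> h"]
      gU_line_inner_deriv by auto
  have "norm ((x + s *\<^sub>R h) + t *\<^sub>R k - x) \<le> norm (s *\<^sub>R h) + norm (t *\<^sub>R k)"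
    using norm_triangle_ineq[of "s *\<^sub>R h" "t *\<^sub>R k"] by (simp add: add.assoc)
  also have "\<dots> \<le> norm h + norm k"
    using s t by (intro add_mono) (auto simp: abs_of_pos intro!: mult_left_le_one_le)
  finally show ?thesis
    using s(3) t(3) by (intro exI[of _ "(x + s *\<^sub>R h) + t *\<^sub>R k"]) (simp add: \<psi>_def algebra_simps)
qed

text \<open>Schwarz's theorem. The second difference with increments \<open>t n *\<^sub>R h\<close>
  and \<open>t n *\<^sub>R k\<close> is evaluated in both orders; after division by the square of
  \<open>t n\<close>, continuity of \<open>HU\<close> moves both intermediate points to
  \<open>x\<close>.\<close>

lemma hess_symmetric: "HU x h \<bullet> k = HU x k \<bullet> h"
proof -
  define t :: "nat \<Rightarrow> real" where "t n = 1 / real (Suc n)" for n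
  have t0: "t \<longlonglongrightarrow> 0" unfolding t_def by (rule LIMSEQ_Suc[OF lim_1_over_n])
  have "\<exists>\<xi> \<xi>'. norm (\<xi> - x) \<le> t n * (norm h + norm k) \<and> norm (\<xi>' - x) \<le> t n * (norm h + norm k)
      \<and> HU \<xi> h \<bullet> k = HU \<xi>' k \<bullet> h" for n
  proof -
    have tp: "t n > 0" by (simp add: t_def)
    obtain \<xi> where \<xi>: "norm (\<xi> - x) \<le> norm (t n *\<^sub>R k) + norm (t n *\<^sub>R h)"
      "U (x + t n *\<^sub>R k + t n *\<^sub>R h) - U (x + t n *\<^sub>R k) - U (x + t n *\<^sub>R h) + U x = HU \<xi> (t n *\<^sub>R h) \<bullet> (t n *\<^sub>R k)"
      using mixed_difference by blast
    obtain \<xi>' where \<xi>': "norm (\<xi>' - x) \<le> norm (t n *\<^sub>R h) + norm (t n *\<^sub>R k)"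
      "U (x + t n *\<^sub>R h + t n *\<^sub>R k) - U (x + t n *\<^sub>R h) - U (x + t n *\<^sub>R k) + U x = HU \<xi>' (t n *\<^sub>R k) \<bullet> (t n *\<^sub>R h)"
      using mixed_difference by blast
    have "HU \<xi> (t n *\<^sub>R h) \<bullet> (t n *\<^sub>R k) = HU \<xi>' (t n *\<^sub>R k) \<bullet> (t n *\<^sub>R h)"
      using \<xi>(2) \<xi>'(2) by (simp add: algebra_simps)
    then have "HU \<xi> h \<bullet> k = HU \<xi>' k \<bullet> h"
      using tp by (simp add: blinfun.scaleR_right)
    then show ?thesis using \<xi>(1) \<xi>'(1) tp by (intro exI[of _ \<xi>] exI[of _ \<xi>']) (simp add: algebra_simps)
  qed
  then obtain \<xi> \<xi>' where \<xi>: "\<And>n. norm (\<xi> n - x) \<le> t n * (norm h + norm k)"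
    "\<And>n. norm (\<xi>' n - x) \<le> t n * (norm h + norm k)" "\<And>n. HU (\<xi> n) h \<bullet> k = HU (\<xi>' n) k \<bullet> h"
    by metis
  have lim: "(\<lambda>n. HU (z n) u \<bullet> v) \<longlonglongrightarrow> HU x u \<bullet> v" if "\<And>n. norm (z n - x) \<le> t n * (norm h + norm k)" for z u v
  proof -
    have "(\<lambda>n. t n * (norm h + norm k)) \<longlonglongrightarrow> 0"
      using tendsto_mult_left_zero[OF t0] by simp
    then have "(\<lambda>n. z n - x) \<longlonglongrightarrow> 0"
      by (rule Lim_null_comparison[rotated]) (use that in auto)
    then have "z \<longlonglongrightarrow> x" by (simp add: LIM_zero_iff)
    then have "(\<lambda>n. HU (z n)) \<longlonglongrightarrow> HU x"
      using hess_cont by (auto simp: continuous_on_def intro: tendsto_compose)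
    then show ?thesis by (intro tendsto_intros)
  qed
  show ?thesis
    using LIMSEQ_unique[OF lim[OF \<xi>(1), of h k]] lim[OF \<xi>(2), of k h] \<xi>(3) by simp
qed

end

section \<open>Gradient and Hessian estimates under tail convexity\<close>

locale tail_convex_potential = C2_potential +
  fixes \<beta> L m Lb K :: real
  assumes beta: "0 \<le> \<beta>" "\<beta> < 1"
    and grad0: "gU 0 = 0"
    and L: "L \<ge> 0" "\<And>x. norm (HU x) \<le> L"
    and mb: "m > 0" and Lb: "Lb \<ge> 0" and Kb: "K \<ge> 0"
    and tail: "\<And>x y. norm x \<ge> K \<Longrightarrow> norm y = 1 \<Longrightarrow>
          Lb / (1 + rpow (norm x) (3 * \<beta> / 4)) \<ge> HU x y \<bullet> y
        \<and> HU x y \<bullet> y \<ge> m / (1 + rpow (norm x) \<beta>)"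
begin

lemma hess_le: "HU x v \<bullet> v \<le> L * (norm v)\<^sup>2"
proof -
  have "HU x v \<bullet> v \<le> norm (HU x v) * norm v" by (rule norm_cauchy_schwarz)
  also have "\<dots> \<le> (L * norm v) * norm v"
    by (intro mult_right_mono order_trans[OF norm_blinfun] mult_right_mono L) auto
  finally show ?thesis by (simp add: power2_eq_square mult.assoc)
qed

lemma hess_tail:
  assumes "norm x \<ge> K"
  shows "HU x v \<bullet> v \<le> Lb / (1 + rpow (norm x) (3 * \<beta> / 4)) * (norm v)\<^sup>2"
    and "m / (1 + rpow (norm x) \<beta>) * (norm v)\<^sup>2 \<le> HU x v \<bullet> v"
proof -
  have "HU x v \<bullet> v \<le> Lb / (1 + rpow (norm x) (3 * \<beta> / 4)) * (norm v)\<^sup>2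
      \<and> m / (1 + rpow (norm x) \<beta>) * (norm v)\<^sup>2 \<le> HU x v \<bullet> v"
  proof (cases "v = 0")
    case False
    define u where "u = v /\<^sub>R norm v"
    have u: "norm u = 1" "v = norm v *\<^sub>R u" using False by (auto simp: u_def)
    have "HU x v \<bullet> v = (norm v)\<^sup>2 * (HU x u \<bullet> u)"
      by (subst u(2), subst (2) u(2)) (simp add: blinfun.scaleR_right power2_eq_square)
    then show ?thesis
      using tail[OF assms u(1)] mult_left_mono[of _ _ "(norm v)\<^sup>2"] by (metis mult.commute zero_le_power2)
  qed simp
  then show "HU x v \<bullet> v \<le> Lb / (1 + rpow (norm x) (3 * \<beta> / 4)) * (norm v)\<^sup>2"
    "m / (1 + rpow (norm x) \<beta>) * (norm v)\<^sup>2 \<le> HU x v \<bullet> v" by auto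
qed

text \<open>Monotonicity of \<open>rpow\<close> makes the bound uniform on the shell between the
  radii \<open>K\<close> and \<open>r\<close>, so that it can be used along a whole segment.\<close>

lemma hess_tail_lower:
  assumes "K \<le> norm x" "norm x \<le> r"
  shows "m / (1 + rpow r \<beta>) * (norm v)\<^sup>2 \<le> HU x v \<bullet> v"
proof -
  have "m / (1 + rpow r \<beta>) \<le> m / (1 + rpow (norm x) \<beta>)"
    using assms beta mb rpow_nonneg[of "norm x" \<beta>] rpow_nonneg[of r \<beta>]
    by (intro divide_left_mono add_left_mono rpow_mono mult_pos_pos) auto
  then show ?thesis
    using hess_tail(2)[OF assms(1), of v] mult_right_mono[of _ _ "(norm v)\<^sup>2"] by (meson order_trans zero_le_power2)
qed

lemma hess_tail_psd: "K \<le> norm x \<Longrightarrow> 0 \<le> HU x v \<bullet> v"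
  using hess_tail_lower[of x "norm x" v] mb rpow_nonneg[of "norm x" \<beta>]
  by (smt (verit) divide_nonneg_nonneg mult_nonneg_nonneg zero_le_power2)

text \<open>For a symmetric nonnegative form an upper bound on the form also bounds the operator
  norm, by \<open>norm_psd_le\<close>. The bound is uniform outside the ball of radius
  \<open>r\<close>.\<close>

lemma norm_hess_tail_le:
  assumes "K \<le> norm x" "r \<le> norm x" "0 \<le> r"
  shows "norm (HU x v) \<le> Lb / (1 + rpow r (3 * \<beta> / 4)) * norm v"
proof -
  define M where "M = Lb / (1 + rpow r (3 * \<beta> / 4))"
  have M: "0 \<le> M" using Lb rpow_nonneg[of r] by (simp add: M_def)
  have "Lb / (1 + rpow (norm x) (3 * \<beta> / 4)) \<le> M" unfolding M_def
    using assms beta Lb rpow_nonneg[of "norm x" "3 * \<beta> / 4"] rpow_nonneg[of r "3 * \<beta> / 4"]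
    by (intro divide_left_mono add_left_mono rpow_mono mult_pos_pos) auto
  then have ub: "HU x w \<bullet> w \<le> M * (norm w)\<^sup>2" for w
    using hess_tail(1)[OF assms(1), of w] mult_right_mono[of _ _ "(norm w)\<^sup>2"] by (meson order_trans zero_le_power2)
  have "(norm (HU x v))\<^sup>2 \<le> M * (HU x v \<bullet> v)"
    by (intro norm_psd_le hess_symmetric hess_tail_psd[OF assms(1)] ub M)
  also have "\<dots> \<le> M * (M * (norm v)\<^sup>2)" by (intro mult_left_mono ub M)
  also have "\<dots> = (M * norm v)\<^sup>2" by (simp add: power2_eq_square)
  finally show ?thesis unfolding M_def[symmetric] using M by (auto intro: power2_le_imp_le)
qed

lemma norm_gU_le: "norm (gU x) \<le> L * norm x"
proof -
  have "norm (gU (0 + 1 *\<^sub>R x) - gU (0 + 0 *\<^sub>R x)) \<le> L * norm x"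
    by (rule line_bound[OF gU_line_deriv]) (intro order_trans[OF norm_blinfun] mult_right_mono L, auto)
  then show ?thesis by (simp add: grad0)
qed

text \<open>Both curvature bounds are compared at one point of norm \<open>r\<close> in a unit
  direction. The result keeps the contraction factor of the gradient step nonnegative.\<close>

lemma hess_lower_le_L:
  assumes "K \<le> r" shows "m / (1 + rpow r \<beta>) \<le> L"
proof -
  define e :: 'a where "e = (SOME b. b \<in> Basis)"
  have e: "norm e = 1" by (simp add: e_def some_in_eq nonempty_Basis)
  have "norm (r *\<^sub>R e) = r" using e assms Kb by simp
  then show ?thesis
    using hess_tail_lower[of "r *\<^sub>R e" r e] hess_le[of "r *\<^sub>R e" e] assms e by auto
qed

text \<open>Convexity is available only outside radius \<open>K\<close>, so the ray to
  \<open>x\<close> is cut at the point \<open>x0\<close> of norm \<open>K\<close>. On the outer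
  piece the map y - \<gamma> \<nabla>U(y) contracts by the factor
  \<open>1 - \<gamma> * c / 2\<close>; at \<open>x0\<close> the linear growth of the gradient
  suffices.\<close>

lemma norm_gradient_step_le:
  assumes \<gamma>: "0 < \<gamma>" "\<gamma> * L \<le> 1" and x: "K \<le> norm x" "x \<noteq> 0"
  shows "norm (x - \<gamma> *\<^sub>R gU x) \<le> norm x - \<gamma> * (m * (norm x - K) / (2 * (1 + rpow (norm x) \<beta>)) - L * K)"
proof -
  define r where "r = norm x"
  have r: "r > 0" "K \<le> r" using x by (auto simp: r_def)
  define c where "c = m / (1 + rpow r \<beta>)"
  have c: "0 \<le> c" "c \<le> L" using hess_lower_le_L[OF r(2)] mb rpow_nonneg[of r \<beta>] by (auto simp: c_def)
  have \<gamma>c: "\<gamma> * c \<le> 1" using c \<gamma> mult_left_mono[of c L \<gamma>] by linarith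
  define x0 where "x0 = (K / r) *\<^sub>R x"
  define v where "v = x - x0"
  have v': "v = (1 - K / r) *\<^sub>R x" by (simp add: v_def x0_def algebra_simps)
  have nv: "norm v = r - K" unfolding v' using r by (simp add: r_def[symmetric] field_simps)
  have nx0: "norm x0 = K" unfolding x0_def using r Kb by (simp add: r_def[symmetric])
  have nt: "K \<le> norm (x0 + t *\<^sub>R v) \<and> norm (x0 + t *\<^sub>R v) \<le> r" if "0 < t" "t < 1" for t
  proof -
    have "x0 + t *\<^sub>R v = (K / r + t * (1 - K / r)) *\<^sub>R x"
      by (simp add: x0_def v' algebra_simps)
    then have "norm (x0 + t *\<^sub>R v) = \<bar>K / r + t * (1 - K / r)\<bar> * r"
      by (simp add: r_def)
    also have "\<dots> = \<bar>K + t * (r - K)\<bar>"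
      using r by (simp add: abs_mult_pos field_simps)
    also have "\<dots> = K + t * (r - K)" using r Kb that by simp
    finally show ?thesis using that r mult_right_mono[of t 1 "r - K"] by simp
  qed
  have "norm ((x0 + 1 *\<^sub>R v - \<gamma> *\<^sub>R gU (x0 + 1 *\<^sub>R v)) - (x0 + 0 *\<^sub>R v - \<gamma> *\<^sub>R gU (x0 + 0 *\<^sub>R v)))
      \<le> (1 - \<gamma> * c / 2) * norm v"
  proof (rule line_bound[where f = "\<lambda>t. x0 + t *\<^sub>R v - \<gamma> *\<^sub>R gU (x0 + t *\<^sub>R v)" and f' = "\<lambda>t. v - \<gamma> *\<^sub>R HU (x0 + t *\<^sub>R v) v"])
    show "((\<lambda>t. x0 + t *\<^sub>R v - \<gamma> *\<^sub>R gU (x0 + t *\<^sub>R v)) has_vector_derivative v - \<gamma> *\<^sub>R HU (x0 + t *\<^sub>R v) v) (at t)" for t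
      by (auto intro!: derivative_eq_intros gU_line_deriv)
  next
    fix t :: real assume t: "0 < t" "t < 1"
    define y where "y = x0 + t *\<^sub>R v"
    have y: "K \<le> norm y" "norm y \<le> r" using nt[OF t] by (auto simp: y_def)
    define q where "q = HU y v \<bullet> v"
    have q: "0 \<le> q" "c * (norm v)\<^sup>2 \<le> q"
      using hess_tail_psd[OF y(1)] hess_tail_lower[OF y, of v] by (auto simp: q_def c_def)
    \<comment> \<open>Co-coercivity: since \<open>\<gamma> * L \<le> 1\<close>, the second-order
      term costs at most half of the first-order gain \<open>2 * \<gamma> * q\<close>.\<close>
    have "(norm (HU y v))\<^sup>2 \<le> L * q" unfolding q_def
      by (intro norm_psd_le hess_symmetric hess_tail_psd[OF y(1)] hess_le L)
    then have "\<gamma>\<^sup>2 * (norm (HU y v))\<^sup>2 \<le> \<gamma>\<^sup>2 * (L * q)" by (intro mult_left_mono) auto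
    also have "\<dots> = (\<gamma> * L) * (\<gamma> * q)" by (simp add: power2_eq_square)
    also have "\<dots> \<le> 1 * (\<gamma> * q)" using \<gamma> q by (intro mult_right_mono) auto
    finally have A: "\<gamma>\<^sup>2 * (norm (HU y v))\<^sup>2 \<le> \<gamma> * q" by simp
    have "(norm (v - \<gamma> *\<^sub>R HU y v))\<^sup>2 = (norm v)\<^sup>2 - 2 * \<gamma> * q + \<gamma>\<^sup>2 * (norm (HU y v))\<^sup>2"
      unfolding power2_norm_eq_inner q_def by (simp add: inner_simps inner_commute power2_eq_square)
    also have "\<dots> \<le> (norm v)\<^sup>2 - \<gamma> * q" using A by simp
    also have "\<dots> \<le> (norm v)\<^sup>2 - \<gamma> * (c * (norm v)\<^sup>2)" using q \<gamma> by simp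
    \<comment> \<open>This is 1 - s \<le> (1 - s/2)^2 with \<open>s = \<gamma> * c\<close>.\<close>
    also have "\<dots> \<le> ((1 - \<gamma> * c / 2) * norm v)\<^sup>2"
    proof -
      have "((1 - \<gamma> * c / 2) * norm v)\<^sup>2 = (norm v)\<^sup>2 - \<gamma> * (c * (norm v)\<^sup>2) + (\<gamma> * c * norm v / 2)\<^sup>2"
        by (simp add: power2_eq_square algebra_simps)
      then show ?thesis by simp
    qed
    finally show "norm (v - \<gamma> *\<^sub>R HU (x0 + t *\<^sub>R v) v) \<le> (1 - \<gamma> * c / 2) * norm v"
      unfolding y_def using \<gamma>c by (auto intro: power2_le_imp_le)
  qed
  then have "norm ((x - \<gamma> *\<^sub>R gU x) - (x0 - \<gamma> *\<^sub>R gU x0)) \<le> (1 - \<gamma> * c / 2) * (r - K)"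
    by (simp add: v_def nv[unfolded v_def])
  moreover have "norm (x0 - \<gamma> *\<^sub>R gU x0) \<le> K + \<gamma> * (L * K)"
    using norm_triangle_ineq4[of x0 "\<gamma> *\<^sub>R gU x0"] norm_gU_le[of x0] \<gamma> nx0
    by (smt (verit) mult_left_mono norm_scaleR)
  ultimately have "norm (x - \<gamma> *\<^sub>R gU x) \<le> K + \<gamma> * (L * K) + (1 - \<gamma> * c / 2) * (r - K)"
    using norm_triangle_ineq[of "(x - \<gamma> *\<^sub>R gU x) - (x0 - \<gamma> *\<^sub>R gU x0)" "x0 - \<gamma> *\<^sub>R gU x0"] by simp
  also have "\<dots> = r - \<gamma> * (c / 2 * (r - K) - L * K)" by (simp add: algebra_simps)
  also have "c / 2 * (r - K) = m * (r - K) / (2 * (1 + rpow r \<beta>))" by (simp add: c_def)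
  finally show ?thesis by (simp add: r_def)
qed

text \<open>The gain per unit of step size is arbitrary, and for a given \<open>B\<close> the radius
  serves all admissible step sizes. It drives both the growth of \<open>U\<close> and the drift of
  the chain.\<close>

lemma gradient_step_gain:
  "\<exists>R>0. \<forall>\<gamma> x. 0 < \<gamma> \<longrightarrow> \<gamma> * L \<le> 1 \<longrightarrow> R \<le> norm x \<longrightarrow> norm (x - \<gamma> *\<^sub>R gU x) \<le> norm x - \<gamma> * B"
proof -
  obtain R where R: "R > 0" "\<And>r. r \<ge> R \<Longrightarrow> B + L * K \<le> m * (r - K) / (2 * (1 + rpow r \<beta>))"
    using rpow_growth[OF beta(2,1) mb, of "B + L * K" K] by blast
  have "norm (x - \<gamma> *\<^sub>R gU x) \<le> norm x - \<gamma> * B" if "0 < \<gamma>" "\<gamma> * L \<le> 1" "max R K \<le> norm x" for \<gamma> x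
  proof -
    have "norm (x - \<gamma> *\<^sub>R gU x) \<le> norm x - \<gamma> * (m * (norm x - K) / (2 * (1 + rpow (norm x) \<beta>)) - L * K)"
      using that R(1) by (intro norm_gradient_step_le) auto
    also have "\<dots> \<le> norm x - \<gamma> * B"
      using R(2)[of "norm x"] that by simp
    finally show ?thesis .
  qed
  then show ?thesis using R(1) by (intro exI[of _ "max R K"]) auto
qed

text \<open>By Cauchy-Schwarz the shrinking of the gradient step bounds the radial derivative of
  \<open>U\<close> below by \<open>B\<close> outside a ball; integrating along rays gives the claim.
  As \<open>B\<close> is arbitrary, all exponential moments of the target are finite.\<close>

lemma U_superlinear: "\<exists>C. \<forall>x. B * norm x - C \<le> U x"
proof -
  obtain R where R: "R > 0" "\<And>\<gamma> x. 0 < \<gamma> \<Longrightarrow> \<gamma> * L \<le> 1 \<Longrightarrow> R \<le> norm x \<Longrightarrow> norm (x - \<gamma> *\<^sub>R gU x) \<le> norm x - \<gamma> * B"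
    using gradient_step_gain[of B] by blast
  \<comment> \<open>An auxiliary step size: any value with \<open>\<gamma> * L \<le> 1\<close>
    serves, since it cancels from the radial inequality.\<close>
  define \<gamma> where "\<gamma> = 1 / (L + 1)"
  have \<gamma>: "0 < \<gamma>" "\<gamma> * L \<le> 1" using L by (auto simp: \<gamma>_def field_simps)
  have radial: "B * norm x \<le> gU x \<bullet> x" if "R \<le> norm x" for x
  proof -
    have n: "norm x > 0" using that R by linarith
    have "(x - \<gamma> *\<^sub>R gU x) \<bullet> x \<le> norm (x - \<gamma> *\<^sub>R gU x) * norm x" by (rule norm_cauchy_schwarz)
    also have "\<dots> \<le> (norm x - \<gamma> * B) * norm x" using R(2)[OF \<gamma> that] by (intro mult_right_mono) auto
    finally have "\<gamma> * (B * norm x) \<le> \<gamma> * (gU x \<bullet> x)"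
      by (simp add: inner_simps power2_norm_eq_inner[symmetric] power2_eq_square algebra_simps)
    then show ?thesis using \<gamma> by simp
  qed
  obtain D where D: "\<And>x. norm x \<le> R \<Longrightarrow> D \<le> U x"
  proof -
    have "compact (U ` cball 0 R)" by (intro compact_continuous_image U_continuous compact_cball)
    then have "bdd_below (U ` cball 0 R)" by (simp add: bounded_imp_bdd_below compact_imp_bounded)
    then show ?thesis using that by (fastforce simp: bdd_below_def)
  qed
  define C where "C = \<bar>B\<bar> * R - D"
  have "B * norm x - C \<le> U x" for x
  proof (cases "norm x \<le> R")
    case True
    have "B * norm x \<le> \<bar>B\<bar> * R" using True by (intro mult_mono) auto
    then show ?thesis using D[OF True] by (simp add: C_def)
  next
    case False
    define r where "r = norm x"
    define e where "e = x /\<^sub>R r"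
    have r: "r > R" "r > 0" using False R by (auto simp: r_def)
    have e: "norm e = 1" "x = r *\<^sub>R e" using r by (auto simp: e_def r_def)
    obtain s where s: "R < s" "s < r" "U (0 + r *\<^sub>R e) - U (0 + R *\<^sub>R e) = (r - R) * (gU (0 + s *\<^sub>R e) \<bullet> e)"
      using MVT2[OF r(1), of "\<lambda>s. U (0 + s *\<^sub>R e)" "\<lambda>s. gU (0 + s *\<^sub>R e) \<bullet> e"]
        U_line_deriv[of 0 e] by auto
    have "B * s \<le> gU (s *\<^sub>R e) \<bullet> (s *\<^sub>R e)" using radial[of "s *\<^sub>R e"] s R e by simp
    then have "B \<le> gU (s *\<^sub>R e) \<bullet> e" using s R by simp
    then have "(r - R) * B \<le> U x - U (R *\<^sub>R e)"
      using s r e(2) mult_left_mono[of B "gU (s *\<^sub>R e) \<bullet> e" "r - R"] by simp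
    moreover have "D \<le> U (R *\<^sub>R e)" using R e by (intro D) simp
    moreover have "B * R \<le> \<bar>B\<bar> * R" using R by (intro mult_right_mono) auto
    ultimately show ?thesis by (simp add: C_def r_def[symmetric] algebra_simps)
  qed
  then show ?thesis by blast
qed

text \<open>The Taylor remainder, at least \<open>c / 2 * (norm h)\<^sup>2\<close>, pays for
  \<open>\<gamma> / 2 * (norm D)\<^sup>2\<close>: one half of this is explicit in the decomposition,
  the other comes from Young's inequality for \<open>w \<bullet> D / 2\<close>. What remains is
  |w|^2 / (4\<gamma>) \<le> 1/2.\<close>

lemma log_ratio_lower_bound:
  assumes \<gamma>: "0 < \<gamma>" "\<gamma> \<le> 1/4" "\<gamma> * L \<le> 1/4" "\<gamma> * Lb\<^sup>2 \<le> m / 4"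
    and x: "4 \<le> norm x" "2 * K \<le> norm x"
    and y: "(norm (y - x + \<gamma> *\<^sub>R gU x))\<^sup>2 \<le> 2 * \<gamma>"
  shows "-1/2 \<le> U x - U y + ((norm (y - x + \<gamma> *\<^sub>R gU x))\<^sup>2 - (norm (x - y + \<gamma> *\<^sub>R gU y))\<^sup>2) / (4 * \<gamma>)"
proof -
  define h where "h = y - x"
  define w where "w = y - x + \<gamma> *\<^sub>R gU x"
  define D where "D = gU y - gU x"
  \<comment> \<open>The increment \<open>h\<close> has norm at most \<open>u\<close>, so the segment
    from \<open>x\<close> to \<open>y\<close> stays between the radii \<open>u\<close> and
    \<open>3 * u\<close>, where the tail bounds apply uniformly.\<close>
  define u where "u = norm x / 2"
  have u: "u \<ge> 2" "K \<le> u" "norm x = 2 * u" using x by (auto simp: u_def)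
  have yh: "y = x + 1 *\<^sub>R h" by (simp add: h_def)
  have "norm w \<le> 1"
    using y \<gamma> unfolding w_def[symmetric] by (auto intro: power2_le_imp_le[of _ 1])
  moreover have "norm (\<gamma> *\<^sub>R gU x) \<le> u / 2"
  proof -
    have "norm (\<gamma> *\<^sub>R gU x) \<le> \<gamma> * (L * norm x)" using norm_gU_le[of x] \<gamma> by simp
    also have "\<dots> \<le> 1/4 * norm x" using \<gamma> by (simp only: mult.assoc[symmetric]) (intro mult_right_mono, auto)
    finally show ?thesis using u by simp
  qed
  moreover have "h = w - \<gamma> *\<^sub>R gU x" by (simp add: h_def w_def)
  ultimately have nh: "norm h \<le> u" using norm_triangle_ineq4[of w "\<gamma> *\<^sub>R gU x"] u by simp
  have seg: "u \<le> norm (x + t *\<^sub>R h) \<and> norm (x + t *\<^sub>R h) \<le> 3 * u" if "0 \<le> t" "t \<le> 1" for t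
  proof -
    have "norm (t *\<^sub>R h) \<le> u" using that nh mult_left_le_one_le[of "norm h" t] by simp
    then show ?thesis
      using norm_triangle_ineq[of x "t *\<^sub>R h"] norm_diff_ineq[of x "t *\<^sub>R h"] u by linarith
  qed
  define M where "M = Lb / (1 + rpow u (3 * \<beta> / 4))"
  define c where "c = m / (1 + rpow (3 * u) \<beta>)"
  have "norm (gU (x + 1 *\<^sub>R h) - gU (x + 0 *\<^sub>R h)) \<le> M * norm h"
  proof (rule line_bound[OF gU_line_deriv])
    fix t :: real assume "0 < t" "t < 1"
    then have "u \<le> norm (x + t *\<^sub>R h)" using seg[of t] by simp
    then show "norm (HU (x + t *\<^sub>R h) h) \<le> M * norm h"
      unfolding M_def using u by (intro norm_hess_tail_le) auto
  qed
  then have D: "norm D \<le> M * norm h" by (simp add: D_def h_def)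
  have M: "0 \<le> M" using Lb rpow_nonneg[of u] by (simp add: M_def)
  have convex: "c / 2 * (norm h)\<^sup>2 \<le> U x - U y + gU y \<bullet> h"
  proof -
    \<comment> \<open>The derivatives of \<open>U\<close> along the segment, for a second-order
      Taylor expansion at t = 1, the point \<open>y\<close>, evaluated at t = 0.\<close>
    define df where "df k t = (if k = 0 then U (x + t *\<^sub>R h) else if k = 1 then gU (x + t *\<^sub>R h) \<bullet> h else HU (x + t *\<^sub>R h) h \<bullet> h)"
      for k :: nat and t
    have "DERIV (df k) t :> df (Suc k) t" if "k < 2" for k t
    proof -
      have "k = 0 \<or> k = 1" using that by auto
      then show ?thesis using U_line_deriv[of x h t] gU_line_inner_deriv[of x h h t] by (auto simp: df_def[abs_def])
    qed
    then obtain t where t: "0 < t" "t < 1"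
      "df 0 0 = (\<Sum>k<2. (df k 1 / fact k) * (0 - 1)^k) + (df 2 t / fact 2) * (0 - 1)^2"
      using Taylor_down[of 2 df "df 0" 0 1 1] by auto
    have "c * (norm h)\<^sup>2 \<le> HU (x + t *\<^sub>R h) h \<bullet> h"
      unfolding c_def using seg[of t] t u by (intro hess_tail_lower) auto
    moreover have "U x = U y - gU y \<bullet> h + (HU (x + t *\<^sub>R h) h \<bullet> h) / 2"
      using t(3) by (simp add: df_def yh numeral_2_eq_2)
    ultimately show ?thesis by simp
  qed
  \<comment> \<open>Up to constants \<open>M\<^sup>2\<close> is u^(-3\<beta>/2) and \<open>c\<close>
    is u^(-\<beta>), so for u \<ge> 1 the exponents compare the right way. The factor 1/4 in the
    bound on \<open>\<gamma> * Lb\<^sup>2\<close> absorbs 1 + (3u)^\<beta> \<le> 4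
    u^\<beta>.\<close>
  have key: "\<gamma> * M\<^sup>2 \<le> c"
  proof -
    have rp: "rpow (3 * u) \<beta> = 3 powr \<beta> * u powr \<beta>" "rpow u (3 * \<beta> / 4) = u powr (3 * \<beta> / 4)"
      using u by (auto simp: rpow_def powr_mult)
    have ge1: "1 \<le> u powr \<beta>" using u beta by (simp add: ge_one_powr_ge_zero)
    have "3 powr \<beta> \<le> (3::real) powr 1" using beta by (intro powr_mono) auto
    then have "1 + rpow (3 * u) \<beta> \<le> u powr \<beta> + 3 * u powr \<beta>"
      unfolding rp using ge1 by (intro add_mono mult_right_mono) auto
    also have "\<dots> = 4 * u powr \<beta>" by simp
    finally have "\<gamma> * Lb\<^sup>2 * (1 + rpow (3 * u) \<beta>) \<le> m / 4 * (4 * u powr \<beta>)"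
      using \<gamma> rpow_nonneg[of "3 * u" \<beta>] mb by (intro mult_mono) auto
    also have "\<dots> = m * u powr \<beta>" by simp
    also have "\<dots> \<le> m * u powr (3 * \<beta> / 4 + 3 * \<beta> / 4)"
      using mb u beta by (intro mult_left_mono powr_mono) auto
    also have "\<dots> = m * (u powr (3 * \<beta> / 4))\<^sup>2" by (simp only: powr_add power2_eq_square)
    also have "\<dots> \<le> m * (1 + rpow u (3 * \<beta> / 4))\<^sup>2" unfolding rp
      using mb by (intro mult_left_mono power_mono) auto
    finally have "\<gamma> * Lb\<^sup>2 * (1 + rpow (3 * u) \<beta>) \<le> m * (1 + rpow u (3 * \<beta> / 4))\<^sup>2" .
    moreover have "0 < 1 + rpow (3 * u) \<beta>" "0 < (1 + rpow u (3 * \<beta> / 4))\<^sup>2"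
      using rpow_nonneg[of "3 * u" \<beta>] rpow_nonneg[of u "3 * \<beta> / 4"] by auto
    ultimately show ?thesis
      unfolding M_def c_def power_divide by (simp only: times_divide_eq_right pos_divide_le_eq pos_le_divide_eq times_divide_eq_left mult.commute)
  qed
  have "\<gamma> * (norm D)\<^sup>2 \<le> \<gamma> * (M * norm h)\<^sup>2" using \<gamma> D by (intro mult_left_mono power_mono) auto
  also have "\<dots> = \<gamma> * M\<^sup>2 * (norm h)\<^sup>2" by (simp add: power_mult_distrib)
  also have "\<dots> \<le> c * (norm h)\<^sup>2" using key by (intro mult_right_mono) auto
  finally have 1: "\<gamma> * (norm D)\<^sup>2 \<le> c * (norm h)\<^sup>2" .
  have 2: "w \<bullet> D / 2 \<le> \<gamma> / 4 * (norm D)\<^sup>2 + 1 / 2"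
  proof -
    have "0 \<le> (norm (w - \<gamma> *\<^sub>R D))\<^sup>2" by simp
    also have "\<dots> = (norm w)\<^sup>2 - 2 * \<gamma> * (w \<bullet> D) + \<gamma>\<^sup>2 * (norm D)\<^sup>2"
      unfolding power2_norm_eq_inner by (simp add: inner_simps inner_commute power2_eq_square)
    also have "\<dots> \<le> 2 * \<gamma> - 2 * \<gamma> * (w \<bullet> D) + \<gamma>\<^sup>2 * (norm D)\<^sup>2" using y by (simp add: w_def)
    also have "\<dots> = 4 * \<gamma> * (1 / 2 + \<gamma> / 4 * (norm D)\<^sup>2 - w \<bullet> D / 2)"
      by (simp add: algebra_simps power2_eq_square)
    finally show ?thesis using \<gamma> by (simp add: zero_le_mult_iff)
  qed
  show ?thesis
    unfolding log_ratio_decomposition[OF \<gamma>(1)] using convex 1 2 unfolding w_def D_def h_def by linarith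
qed

end

section \<open>Harris' theorem\<close>

text \<open>The setwise bound is an inequality of measures, and integrals of nonnegative functions
  are monotone in the measure. Integrability under \<open>N\<close> is part of the conclusion, so no
  moment of the minorizing measure has to be assumed.\<close>

lemma integral_le_of_minorization:
  assumes sets: "sets N = sets M" and fin: "finite_measure M" "finite_measure N" and eps: "0 \<le> \<epsilon>"
    and minor: "\<And>A. A \<in> sets M \<Longrightarrow> \<epsilon> * measure N A \<le> measure M A"
    and f: "integrable M f" "\<And>x. 0 \<le> f x"
  shows "\<epsilon> * (\<integral>x. f x \<partial>N) \<le> (\<integral>x. f x \<partial>M)" and "0 < \<epsilon> \<Longrightarrow> integrable N f"
proof -
  interpret M: finite_measure M by fact
  interpret N: finite_measure N by fact
  have [measurable_cong]: "sets N = sets M" by fact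
  have [measurable]: "f \<in> borel_measurable M" "f \<in> borel_measurable N"
    using f(1) sets by (auto simp: measurable_cong_sets[OF sets refl])
  have "scale_measure (ennreal \<epsilon>) N \<le> M"
    using minor eps by (subst le_measure)
      (auto simp: sets M.emeasure_eq_measure N.emeasure_eq_measure ennreal_mult[symmetric] intro!: ennreal_leI)
  then have "(\<integral>\<^sup>+x. ennreal (f x) \<partial>scale_measure (ennreal \<epsilon>) N) \<le> (\<integral>\<^sup>+x. ennreal (f x) \<partial>M)"
    by (intro nn_integral_mono_measure) (auto simp: sets)
  then have le: "ennreal \<epsilon> * (\<integral>\<^sup>+x. ennreal (f x) \<partial>N) \<le> ennreal (\<integral>x. f x \<partial>M)"
    using f by (simp add: nn_integral_scale_measure nn_integral_eq_integral)
  show int: "integrable N f" if "0 < \<epsilon>"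
  proof (rule integrableI_nonneg)
    show "(\<integral>\<^sup>+x. ennreal (f x) \<partial>N) < \<infinity>"
      using le that by (auto simp: less_top[symmetric] ennreal_mult_top top_unique)
  qed (use f in auto)
  show "\<epsilon> * (\<integral>x. f x \<partial>N) \<le> (\<integral>x. f x \<partial>M)"
  proof (cases "\<epsilon> = 0")
    case True then show ?thesis using f by simp
  next
    case False
    then have "integrable N f" using int eps by simp
    then show ?thesis using le f eps
      by (simp add: nn_integral_eq_integral ennreal_mult[symmetric])
  qed
qed

section \<open>Markov kernels with a drift condition: iterates and integrals\<close>

primrec kernel_iter :: "('a::topological_space \<Rightarrow> 'a measure) \<Rightarrow> nat \<Rightarrow> 'a \<Rightarrow> 'a measure" where
  "kernel_iter P 0 x = return borel x"
| "kernel_iter P (Suc k) x = kernel_iter P k x \<bind> P"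

locale drift_kernel =
  fixes P :: "'a::topological_space \<Rightarrow> 'a measure" and V :: "'a \<Rightarrow> real" and lam b :: real
  assumes kernel[measurable]: "P \<in> borel \<rightarrow>\<^sub>M prob_algebra borel"
    and V_measurable[measurable]: "V \<in> borel_measurable borel"
    and V_ge_1: "\<And>x. 1 \<le> V x"
    and lam_range: "0 \<le> lam" "lam < 1" and b: "0 \<le> b"
    and drift: "\<And>x. (\<integral>\<^sup>+y. ennreal (V y) \<partial>P x) \<le> ennreal (lam * V x + b)"
begin

lemma V_nonneg: "0 \<le> V x"
  using V_ge_1[of x] by simp

lemma kernel_subprob: "P \<in> borel \<rightarrow>\<^sub>M subprob_algebra borel"
  by (rule measurable_prob_algebraD[OF kernel])

lemma prob_space_P: "prob_space (P x)" and sets_P[simp, measurable_cong]: "sets (P x) = sets borel"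
  using measurable_space[OF kernel, of x] by (auto simp: space_prob_algebra)

lemma space_P[simp]: "space (P x) = UNIV"
  using sets_eq_imp_space_eq[OF sets_P, of x] by simp

text \<open>Admissible measures and V-bounded functions form a dual pair on which the kernel acts
  from either side: \<open>admissible_bind\<close> and \<open>V_bounded_P\<close> show that both
  classes are stable, and \<open>integrable_V_bounded\<close> makes every pairing finite.\<close>

definition admissible :: "'a measure \<Rightarrow> bool" where
  "admissible N \<longleftrightarrow> prob_space N \<and> sets N = sets borel \<and> integrable N V"

definition V_bounded :: "('a \<Rightarrow> real) \<Rightarrow> bool" where
  "V_bounded f \<longleftrightarrow> f \<in> borel_measurable borel \<and> (\<exists>c. \<forall>x. \<bar>f x\<bar> \<le> c * V x)"

lemma admissible_P: "admissible (P x)"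
proof -
  have "integrable (P x) V"
    using drift[of x] V_nonneg by (intro integrableI_nonneg) (auto intro: order_le_less_trans)
  then show ?thesis by (simp add: admissible_def prob_space_P)
qed

lemma integrable_V_bounded:
  assumes "admissible N" "V_bounded f"
  shows "integrable N f"
proof -
  obtain c where c: "\<And>x. \<bar>f x\<bar> \<le> c * V x" using assms by (auto simp: V_bounded_def)
  have [measurable_cong]: "sets N = sets borel" using assms by (simp add: admissible_def)
  have f[measurable]: "f \<in> borel_measurable borel" using assms by (simp add: V_bounded_def)
  have fN: "f \<in> borel_measurable N" by measurable
  show ?thesis
    by (rule Bochner_Integration.integrable_bound[of N "\<lambda>x. c * V x" f])
       (use assms fN in \<open>auto simp: admissible_def intro!: AE_I2 order_trans[OF c]\<close>)
qed

lemma V_bounded_V: "V_bounded V"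
  using V_nonneg by (auto simp: V_bounded_def intro!: exI[of _ 1])

lemma V_bounded_const: "V_bounded (\<lambda>_. c)"
proof -
  have "\<bar>c\<bar> \<le> \<bar>c\<bar> * V x" for x using V_ge_1[of x] mult_left_mono[of 1 "V x" "\<bar>c\<bar>"] by simp
  then show ?thesis by (auto simp: V_bounded_def)
qed

lemma integral_P_V_le: "(\<integral>y. V y \<partial>P x) \<le> lam * V x + b"
proof -
  have "ennreal (\<integral>y. V y \<partial>P x) \<le> ennreal (lam * V x + b)"
    using drift[of x] integrable_V_bounded[OF admissible_P V_bounded_V] V_nonneg by (simp add: nn_integral_eq_integral)
  then show ?thesis using V_nonneg[of x] lam_range b by (subst (asm) ennreal_le_iff) auto
qed

lemma V_bounded_P:
  assumes "V_bounded f"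
  shows "V_bounded (\<lambda>x. \<integral>y. f y \<partial>P x)"
proof -
  obtain c where c: "\<And>x. \<bar>f x\<bar> \<le> c * V x" using assms by (auto simp: V_bounded_def)
  have c0: "0 \<le> c" using c[of undefined] V_ge_1[of undefined]
    by (smt (verit) mult_less_0_iff)
  have [measurable]: "f \<in> borel_measurable borel" using assms by (simp add: V_bounded_def)
  have "\<bar>\<integral>y. f y \<partial>P x\<bar> \<le> c * (lam + b) * V x" for x
  proof -
    have "\<bar>\<integral>y. f y \<partial>P x\<bar> \<le> (\<integral>y. \<bar>f y\<bar> \<partial>P x)" by (rule integral_abs_bound)
    also have "\<dots> \<le> (\<integral>y. c * V y \<partial>P x)"
      using integrable_V_bounded[OF admissible_P assms] integrable_V_bounded[OF admissible_P V_bounded_V] c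
      by (intro integral_mono) auto
    also have "\<dots> \<le> c * (lam * V x + b)" using integral_P_V_le[of x] c0 by (simp add: mult_left_mono)
    also have "\<dots> \<le> c * (lam * V x + b * V x)"
      using c0 b V_ge_1[of x] mult_left_mono[of 1 "V x" b] by (intro mult_left_mono) auto
    finally show ?thesis by (simp add: algebra_simps)
  qed
  moreover have "(\<lambda>x. \<integral>y. f y \<partial>P x) \<in> borel_measurable borel"
    using kernel_subprob by measurable
  ultimately show ?thesis by (auto simp: V_bounded_def)
qed

lemma admissible_bind:
  assumes "admissible N"
  shows "admissible (N \<bind> P)"
proof -
  have N: "prob_space N" "sets N = sets borel" using assms by (auto simp: admissible_def)
  interpret prob_space N by fact
  have PN: "P \<in> N \<rightarrow>\<^sub>M subprob_algebra borel"
    using kernel_subprob by (simp add: measurable_cong_sets[OF N(2) refl])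
  have ne: "space N \<noteq> {}" by (rule not_empty)
  have sets: "sets (N \<bind> P) = sets borel"
    by (rule sets_bind[OF _ ne]) simp
  have [measurable_cong]: "sets N = sets borel" by fact
  have "prob_space (N \<bind> P)"
    using prob_space_P PN by (intro prob_space_bind) auto
  moreover have "integrable (N \<bind> P) V"
  proof (rule integrableI_nonneg)
    have "(\<integral>\<^sup>+x. ennreal (V x) \<partial>(N \<bind> P)) = (\<integral>\<^sup>+x. \<integral>\<^sup>+y. ennreal (V y) \<partial>P x \<partial>N)"
      by (rule nn_integral_bind[OF _ PN]) measurable
    also have "\<dots> \<le> (\<integral>\<^sup>+x. ennreal (lam * V x + b) \<partial>N)" by (intro nn_integral_mono drift)
    also have "\<dots> = ennreal (\<integral>x. lam * V x + b \<partial>N)"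
      using assms V_nonneg lam_range b by (intro nn_integral_eq_integral) (auto simp: admissible_def)
    also have "\<dots> < \<infinity>" by simp
    finally show "(\<integral>\<^sup>+x. ennreal (V x) \<partial>(N \<bind> P)) < \<infinity>" .
  qed (use V_nonneg sets in \<open>auto simp: measurable_cong_sets[OF sets refl]\<close>)
  ultimately show ?thesis using sets by (simp add: admissible_def)
qed

lemma integral_bind_nonneg:
  assumes N: "admissible N" and f: "V_bounded f" "\<And>x. 0 \<le> f x"
  shows "(\<integral>x. f x \<partial>(N \<bind> P)) = (\<integral>x. (\<integral>y. f y \<partial>P x) \<partial>N)"
proof -
  have sN: "sets N = sets borel" using N by (auto simp: admissible_def)
  have PN: "P \<in> N \<rightarrow>\<^sub>M subprob_algebra borel"
    using kernel_subprob by (simp add: measurable_cong_sets[OF sN refl])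
  have "ennreal (\<integral>x. f x \<partial>(N \<bind> P)) = (\<integral>\<^sup>+x. ennreal (f x) \<partial>(N \<bind> P))"
    using integrable_V_bounded[OF admissible_bind[OF N] f(1)] f(2) by (simp add: nn_integral_eq_integral)
  also have "\<dots> = (\<integral>\<^sup>+x. \<integral>\<^sup>+y. ennreal (f y) \<partial>P x \<partial>N)"
    using f(1) by (intro nn_integral_bind[OF _ PN]) (auto simp: V_bounded_def)
  also have "\<dots> = (\<integral>\<^sup>+x. ennreal (\<integral>y. f y \<partial>P x) \<partial>N)"
    using integrable_V_bounded[OF admissible_P f(1)] f(2) by (simp add: nn_integral_eq_integral)
  also have "\<dots> = ennreal (\<integral>x. (\<integral>y. f y \<partial>P x) \<partial>N)"
    using integrable_V_bounded[OF N V_bounded_P[OF f(1)]] f(2) by (intro nn_integral_eq_integral) auto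
  finally show ?thesis
    using f(2) by (simp add: integral_nonneg_AE)
qed

lemma V_bounded_add: "V_bounded f \<Longrightarrow> V_bounded g \<Longrightarrow> V_bounded (\<lambda>x. f x + g x)"
  unfolding V_bounded_def
proof (elim conjE exE, intro conjI)
  fix c d assume "\<forall>x. \<bar>f x\<bar> \<le> c * V x" "\<forall>x. \<bar>g x\<bar> \<le> d * V x"
  then have "\<bar>f x + g x\<bar> \<le> (c + d) * V x" for x
    using abs_triangle_ineq[of "f x" "g x"] by (smt (verit) distrib_right)
  then show "\<exists>c. \<forall>x. \<bar>f x + g x\<bar> \<le> c * V x" by blast
qed simp

lemma V_bounded_cmult: "V_bounded f \<Longrightarrow> V_bounded (\<lambda>x. a * f x)"
  unfolding V_bounded_def
proof (elim conjE exE, intro conjI)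
  fix c assume "\<forall>x. \<bar>f x\<bar> \<le> c * V x"
  then have "\<bar>a * f x\<bar> \<le> (\<bar>a\<bar> * c) * V x" for x
    by (simp add: abs_mult mult.assoc mult_left_mono)
  then show "\<exists>c. \<forall>x. \<bar>a * f x\<bar> \<le> c * V x" by blast
qed simp

text \<open>Adding a multiple of \<open>V\<close> makes the function nonnegative, where the extended
  integral applies; the shift is then subtracted, all integrals being finite.\<close>

lemma integral_bind_V_bounded:
  assumes N: "admissible N" and f: "V_bounded f"
  shows "(\<integral>x. f x \<partial>(N \<bind> P)) = (\<integral>x. (\<integral>y. f y \<partial>P x) \<partial>N)"
proof -
  obtain c where c: "\<And>x. \<bar>f x\<bar> \<le> c * V x" using f by (auto simp: V_bounded_def)
  then have nn: "0 \<le> f x + c * V x" "0 \<le> c * V x" for x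
    using c[of x] by linarith+
  have cV: "V_bounded (\<lambda>x. c * V x)" by (intro V_bounded_cmult V_bounded_V)
  note int = integrable_V_bounded[OF admissible_bind[OF N]] integrable_V_bounded[OF admissible_P]
    integrable_V_bounded[OF N V_bounded_P]
  have "(\<integral>x. f x + c * V x \<partial>(N \<bind> P)) = (\<integral>x. (\<integral>y. f y + c * V y \<partial>P x) \<partial>N)"
    by (intro integral_bind_nonneg N V_bounded_add f cV nn)
  moreover have "(\<integral>x. c * V x \<partial>(N \<bind> P)) = (\<integral>x. (\<integral>y. c * V y \<partial>P x) \<partial>N)"
    by (intro integral_bind_nonneg N cV nn)
  moreover have "(\<integral>x. f x + c * V x \<partial>(N \<bind> P)) = (\<integral>x. f x \<partial>(N \<bind> P)) + (\<integral>x. c * V x \<partial>(N \<bind> P))"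
    by (intro Bochner_Integration.integral_add int f cV)
  moreover have "(\<integral>x. (\<integral>y. f y + c * V y \<partial>P x) \<partial>N) = (\<integral>x. (\<integral>y. f y \<partial>P x) \<partial>N) + (\<integral>x. (\<integral>y. c * V y \<partial>P x) \<partial>N)"
    by (subst Bochner_Integration.integral_add[OF int(2)[OF f] int(2)[OF cV]])
       (intro Bochner_Integration.integral_add int f cV)
  ultimately show ?thesis by linarith
qed

lemma admissible_return: "admissible (return borel x)"
proof -
  have "integrable (return borel x) V"
    using V_nonneg by (intro integrableI_nonneg) (auto simp: nn_integral_return)
  then show ?thesis by (simp add: admissible_def prob_space_return)
qed

lemma admissible_iter: "admissible (kernel_iter P k x)"
  by (induction k) (auto intro: admissible_return admissible_bind)

section \<open>Contraction of a weighted oscillation and convergence of the iterates\<close>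

text \<open>The weighted oscillation seminorm of Hairer and Mattingly: the kernel contracts it, because far
  out the drift wins, while on a level set of \<open>V\<close> the common part \<open>\<epsilon> \<nu>\<close> cancels.\<close>

definition osc_le :: "real \<Rightarrow> real \<Rightarrow> ('a \<Rightarrow> real) \<Rightarrow> bool" where
  "osc_le \<theta> c f \<longleftrightarrow> V_bounded f \<and> (\<forall>x y. f x - f y \<le> c * (2 + \<theta> * V x + \<theta> * V y))"

text \<open>Integrates the oscillation bound in both variables, one at a time, so no coupling or
  product measure is formed. Stating it for positive linear functionals of mass \<open>s\<close>
  covers \<open>P x\<close> itself and also what is left after removing \<epsilon> \<nu>, which need
  not be constructed as a measure.\<close>

lemma positive_functional_difference:
  fixes I J :: "('a \<Rightarrow> real) \<Rightarrow> real"
  assumes f: "osc_le \<theta> c f" and s: "0 < s"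
    and I: "\<And>p q r. V_bounded p \<Longrightarrow> V_bounded q \<Longrightarrow> I (\<lambda>x. p x + r * q x) = I p + r * I q"
    and J: "\<And>p q r. V_bounded p \<Longrightarrow> V_bounded q \<Longrightarrow> J (\<lambda>x. p x + r * q x) = J p + r * J q"
    and I0: "\<And>p. V_bounded p \<Longrightarrow> (\<And>x. 0 \<le> p x) \<Longrightarrow> 0 \<le> I p"
    and J0: "\<And>p. V_bounded p \<Longrightarrow> (\<And>x. 0 \<le> p x) \<Longrightarrow> 0 \<le> J p"
    and I1: "I (\<lambda>_. 1) = s" and J1: "J (\<lambda>_. 1) = s"
  shows "I f - J f \<le> c * (2 * s + \<theta> * I V + \<theta> * J V)"
proof -
  have vf: "V_bounded f" and fle: "f x - f y \<le> c * (2 + \<theta> * V x + \<theta> * V y)" for x y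
    using f by (auto simp: osc_le_def)
  note vb = V_bounded_add V_bounded_cmult V_bounded_const V_bounded_V vf
  have step: "I f \<le> s * f v + c * (2 * s + \<theta> * I V + s * \<theta> * V v)" for v
  proof -
    define k where "k = f v + c * 2 + c * \<theta> * V v"
    have "0 \<le> I (\<lambda>u. (k + (c * \<theta>) * V u) + (-1) * f u)"
      using fle[of _ v] by (intro I0 vb) (simp add: k_def algebra_simps)
    also have "\<dots> = I (\<lambda>u. k + (c * \<theta>) * V u) + (-1) * I f" by (intro I vb)
    also have "I (\<lambda>u. k + (c * \<theta>) * V u) = I (\<lambda>u. k) + (c * \<theta>) * I V" by (intro I vb)
    \<comment> \<open>Linearity with zero functions first yields
      \<open>I (\<lambda>_. 0) = 0\<close>, then the value at constants.\<close>
    also have "I (\<lambda>u. k) = k * s"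
      using I[of "\<lambda>_. 0" "\<lambda>_. 1" k] I[of "\<lambda>_. 0" "\<lambda>_. 0" 1] I1 by (simp add: vb)
    finally show ?thesis by (simp add: k_def algebra_simps)
  qed
  define k where "k = c * (2 * s + \<theta> * I V) - I f"
  have "0 \<le> J (\<lambda>v. (k + s * f v) + (s * c * \<theta>) * V v)"
    using step by (intro J0 vb) (simp add: k_def algebra_simps)
  also have "\<dots> = J (\<lambda>v. k + s * f v) + (s * c * \<theta>) * J V" by (intro J vb)
  also have "J (\<lambda>v. k + s * f v) = J (\<lambda>v. k) + s * J f" by (intro J vb)
  also have "J (\<lambda>v. k) = k * s"
    using J[of "\<lambda>_. 0" "\<lambda>_. 1" k] J[of "\<lambda>_. 0" "\<lambda>_. 0" 1] J1 by (simp add: vb)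
  finally have "0 \<le> s * (k + J f + c * \<theta> * J V)" by (simp add: algebra_simps)
  then have "0 \<le> k + J f + c * \<theta> * J V" using s by (simp add: zero_le_mult_iff)
  then show ?thesis by (simp add: k_def algebra_simps)
qed

text \<open>No cancellation is used, only the drift; the additive cost
  \<open>2 * \<theta> * b\<close> is harmless once \<open>V x + V y\<close> is large.\<close>

lemma osc_step_far:
  assumes f: "osc_le \<theta> c f" and c: "0 \<le> c" and \<theta>: "0 \<le> \<theta>"
  shows "(\<integral>u. f u \<partial>P x) - (\<integral>u. f u \<partial>P y) \<le> c * (2 + 2 * \<theta> * b + \<theta> * lam * (V x + V y))"
proof -
  interpret X: prob_space "P x" by (rule prob_space_P)
  interpret Y: prob_space "P y" by (rule prob_space_P)
  note int = integrable_V_bounded[OF admissible_P]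
  have "(\<integral>u. f u \<partial>P x) - (\<integral>u. f u \<partial>P y) \<le> c * (2 * 1 + \<theta> * (\<integral>u. V u \<partial>P x) + \<theta> * (\<integral>u. V u \<partial>P y))"
    by (rule positive_functional_difference[OF f]) (auto simp: int integral_nonneg_AE X.prob_space[simplified] Y.prob_space[simplified])
  also have "\<dots> \<le> c * (2 * 1 + \<theta> * (lam * V x + b) + \<theta> * (lam * V y + b))"
    by (intro mult_left_mono add_mono integral_P_V_le \<theta> c order_refl)
  finally show ?thesis by (simp add: algebra_simps)
qed

lemma osc_step_near:
  assumes f: "osc_le \<theta> c f" and c: "0 \<le> c" and \<theta>: "0 \<le> \<theta>" and eps: "0 < \<epsilon>" "\<epsilon> < 1"
    and nu: "prob_space \<nu>" "sets \<nu> = sets borel"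
    and mx: "\<And>A. A \<in> sets borel \<Longrightarrow> \<epsilon> * measure \<nu> A \<le> measure (P x) A"
    and my: "\<And>A. A \<in> sets borel \<Longrightarrow> \<epsilon> * measure \<nu> A \<le> measure (P y) A"
  shows "(\<integral>u. f u \<partial>P x) - (\<integral>u. f u \<partial>P y) \<le> c * (2 * (1 - \<epsilon>) + 2 * \<theta> * b + \<theta> * lam * (V x + V y))"
proof -
  interpret X: prob_space "P x" by (rule prob_space_P)
  interpret Y: prob_space "P y" by (rule prob_space_P)
  interpret nu: prob_space \<nu> by (rule nu)
  note int = integrable_V_bounded[OF admissible_P]
  have minor: "\<epsilon> * (\<integral>u. p u \<partial>\<nu>) \<le> (\<integral>u. p u \<partial>P z)" "integrable \<nu> p"
    if "V_bounded p" "\<And>u. 0 \<le> p u" "z = x \<or> z = y" for p z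
    using integral_le_of_minorization[of \<nu> "P z" \<epsilon> p] that nu(2) eps mx my int[OF that(1)]
      X.finite_measure_axioms Y.finite_measure_axioms nu.finite_measure_axioms by auto
  have adm: "admissible \<nu>"
    using minor(2)[OF V_bounded_V V_nonneg, of x] nu by (simp add: admissible_def)
  note int_nu = integrable_V_bounded[OF adm]
  \<comment> \<open>The residual functional after removing the common part. It is positive by the
    minorization and has mass 1 - \<epsilon>, and the \<nu>-terms cancel in the difference of
    \<open>I x f\<close> and \<open>I y f\<close>.\<close>
  define I where "I z p = (\<integral>u. p u \<partial>P z) - \<epsilon> * (\<integral>u. p u \<partial>\<nu>)" for z p
  have lin: "I z (\<lambda>x. p x + r * q x) = I z p + r * I z q" if "V_bounded p" "V_bounded q" for z p q r
    using int[OF that(1)] int[OF that(2)] int_nu[OF that(1)] int_nu[OF that(2)] by (simp add: I_def algebra_simps)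
  have IV: "I z V \<le> lam * V z + b" for z
  proof -
    have "0 \<le> (\<integral>u. V u \<partial>\<nu>)" using V_nonneg by (simp add: integral_nonneg_AE)
    then have "0 \<le> \<epsilon> * (\<integral>u. V u \<partial>\<nu>)" using eps by simp
    then show ?thesis using integral_P_V_le[of z] by (simp add: I_def)
  qed
  have nn: "0 \<le> I z p" if "V_bounded p" "\<And>u. 0 \<le> p u" "z = x \<or> z = y" for z p
    using minor(1)[OF that] by (simp add: I_def)
  have one: "I z (\<lambda>_. 1) = 1 - \<epsilon>" for z
    using prob_space.prob_space[OF prob_space_P, of z] nu.prob_space by (simp add: I_def)
  have "I x f - I y f \<le> c * (2 * (1 - \<epsilon>) + \<theta> * I x V + \<theta> * I y V)"
    by (rule positive_functional_difference[OF f]) (use eps in \<open>auto simp: lin one intro: nn\<close>)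
  also have "\<dots> \<le> c * (2 * (1 - \<epsilon>) + \<theta> * (lam * V x + b) + \<theta> * (lam * V y + b))"
    by (intro mult_left_mono add_mono IV \<theta> c order_refl)
  finally show ?thesis by (simp add: I_def algebra_simps)
qed

text \<open>Each iterate appends a kernel step at the end, so the induction replaces
  \<open>f\<close> by its image under \<open>P\<close>; hence \<open>f\<close> and \<open>c\<close>
  must be arbitrary.\<close>

lemma osc_iter:
  assumes contr: "\<And>c f. 0 \<le> c \<Longrightarrow> osc_le \<theta> c f \<Longrightarrow> osc_le \<theta> (\<rho> * c) (\<lambda>x. \<integral>y. f y \<partial>P x)"
    and rho: "0 \<le> \<rho>"
  shows "0 \<le> c \<Longrightarrow> osc_le \<theta> c f \<Longrightarrow> osc_le \<theta> (\<rho> ^ k * c) (\<lambda>x. \<integral>y. f y \<partial>kernel_iter P k x)"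
proof (induction k arbitrary: c f)
  case 0
  then have "f \<in> borel_measurable borel" by (simp add: osc_le_def V_bounded_def)
  then show ?case using 0 by (simp add: integral_return)
next
  case (Suc k)
  have "osc_le \<theta> (\<rho> ^ k * (\<rho> * c)) (\<lambda>x. \<integral>y. (\<integral>z. f z \<partial>P y) \<partial>kernel_iter P k x)"
    by (intro Suc.IH contr Suc.prems mult_nonneg_nonneg rho)
  moreover have "V_bounded f" using Suc.prems by (simp add: osc_le_def)
  ultimately show ?case
    by (simp add: integral_bind_V_bounded[OF admissible_iter] mult_ac)
qed

lemma integral_iter_invariant:
  assumes "admissible N" "N \<bind> P = N" "V_bounded f"
  shows "(\<integral>x. (\<integral>y. f y \<partial>kernel_iter P k x) \<partial>N) = (\<integral>x. f x \<partial>N)"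
  using assms(3)
proof (induction k arbitrary: f)
  case 0
  then show ?case by (simp add: integral_return V_bounded_def)
next
  case (Suc k)
  have "(\<integral>x. (\<integral>y. f y \<partial>kernel_iter P (Suc k) x) \<partial>N) = (\<integral>x. (\<integral>y. (\<integral>z. f z \<partial>P y) \<partial>kernel_iter P k x) \<partial>N)"
    by (simp add: integral_bind_V_bounded[OF admissible_iter Suc.prems])
  also have "\<dots> = (\<integral>x. (\<integral>z. f z \<partial>P x) \<partial>N)"
    by (intro Suc.IH V_bounded_P Suc.prems)
  also have "\<dots> = (\<integral>x. f x \<partial>N)"
    using integral_bind_V_bounded[OF assms(1) Suc.prems] assms(2) by simp
  finally show ?case .
qed

text \<open>If \<open>V x + V y\<close> exceeds \<open>S\<close>, the first hypothesis says that the
  drift outweighs its additive constant; otherwise both points lie in the level set and the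
  minorization applies. With \<theta> small these regimes contract the oscillation by a common
  factor, and integrating over the invariant measure turns this into convergence.\<close>

theorem harris:
  assumes S: "2 * b < (1 - lam) * S" and eps: "0 < \<epsilon>" "\<epsilon> < 1"
    and nu: "prob_space \<nu>" "sets \<nu> = sets borel"
    and minor: "\<And>x A. V x \<le> S \<Longrightarrow> A \<in> sets borel \<Longrightarrow> \<epsilon> * measure \<nu> A \<le> measure (P x) A"
    and N: "admissible N" "N \<bind> P = N"
  obtains C \<rho> where "0 \<le> C" "0 \<le> \<rho>" "\<rho> < 1"
    "\<And>f x k. f \<in> borel_measurable borel \<Longrightarrow> (\<And>x. \<bar>f x\<bar> \<le> V x) \<Longrightarrow>
       \<bar>(\<integral>y. f y \<partial>kernel_iter P k x) - (\<integral>y. f y \<partial>N)\<bar> \<le> C * \<rho> ^ k * V x"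
proof -
  \<comment> \<open>Chosen so that \<open>2 * \<theta> * b \<le> \<epsilon>\<close>: the additive
    drift term uses up at most half of the gain \<open>2 * \<epsilon>\<close> from the minorization,
    which leads to \<open>1 - \<epsilon> / 2\<close> in \<rho>.\<close>
  define \<theta> where "\<theta> = \<epsilon> / (2 * (b + 1))"
  have \<theta>: "0 < \<theta>" using eps b by (simp add: \<theta>_def)
  have \<theta>b: "2 * \<theta> * b \<le> \<epsilon>" using eps b by (simp add: \<theta>_def field_simps)
  define \<delta> where "\<delta> = (1 - lam) * S - 2 * b"
  have \<delta>: "0 < \<delta>" using S by (simp add: \<delta>_def)
  have S0: "0 < S"
    using S b lam_range by (smt (verit) mult_nonneg_nonpos)
  \<comment> \<open>The last entry makes \<open>2 (1 - \<rho>) \<le> \<theta> ((\<rho> - lam) S - 2 b)\<close>, which is what the far region needs.\<close>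
  define \<rho> where "\<rho> = Max {lam, 1 - \<epsilon> / 2, 1 - \<theta> * \<delta> / (2 + \<theta> * S)}"
  have \<rho>: "lam \<le> \<rho>" "1 - \<epsilon> / 2 \<le> \<rho>" "1 - \<theta> * \<delta> / (2 + \<theta> * S) \<le> \<rho>" "\<rho> < 1" "0 \<le> \<rho>"
    using lam_range eps \<theta> \<delta> S0 by (auto simp: \<rho>_def add_pos_pos)
  have far: "2 * (1 - \<rho>) \<le> \<theta> * ((\<rho> - lam) * S - 2 * b)"
  proof -
    have "(1 - \<rho>) * (2 + \<theta> * S) \<le> \<theta> * \<delta>"
    proof (subst pos_le_divide_eq[symmetric])
      show "0 < 2 + \<theta> * S" using \<theta> S0 by (simp add: add_pos_pos)
      show "1 - \<rho> \<le> \<theta> * \<delta> / (2 + \<theta> * S)" using \<rho>(3) by linarith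
    qed
    then show ?thesis by (simp add: \<delta>_def algebra_simps)
  qed
  have contr: "osc_le \<theta> (\<rho> * c) (\<lambda>x. \<integral>y. f y \<partial>P x)" if c: "0 \<le> c" and f: "osc_le \<theta> c f" for c f
    unfolding osc_le_def
  proof (intro conjI allI)
    show "V_bounded (\<lambda>x. \<integral>y. f y \<partial>P x)" using f by (auto simp: osc_le_def intro: V_bounded_P)
    fix x y
    define s where "s = V x + V y"
    have s: "0 \<le> s" "V x \<le> s" "V y \<le> s" using V_nonneg[of x] V_nonneg[of y] by (auto simp: s_def)
    have "(\<integral>u. f u \<partial>P x) - (\<integral>u. f u \<partial>P y) \<le> c * (\<rho> * (2 + \<theta> * s))"
    proof (cases "s \<le> S")
      case True
      have "(\<integral>u. f u \<partial>P x) - (\<integral>u. f u \<partial>P y) \<le> c * (2 * (1 - \<epsilon>) + 2 * \<theta> * b + \<theta> * lam * s)"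
        unfolding s_def using s True \<theta> by (intro osc_step_near[OF f c _ eps nu] minor) auto
      also have "2 * (1 - \<epsilon>) + 2 * \<theta> * b + \<theta> * lam * s \<le> \<rho> * (2 + \<theta> * s)"
      proof -
        have "\<theta> * lam * s \<le> \<theta> * \<rho> * s" using \<rho> \<theta> s by (intro mult_right_mono mult_left_mono) auto
        then show ?thesis using \<rho>(2) \<theta>b by (simp add: algebra_simps)
      qed
      finally show ?thesis using c by (simp add: mult_left_mono)
    next
      case False
      have "(\<integral>u. f u \<partial>P x) - (\<integral>u. f u \<partial>P y) \<le> c * (2 + 2 * \<theta> * b + \<theta> * lam * s)"
        unfolding s_def using \<theta> by (intro osc_step_far[OF f c]) auto
      also have "2 + 2 * \<theta> * b + \<theta> * lam * s \<le> \<rho> * (2 + \<theta> * s)"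
      proof -
        have "\<theta> * ((\<rho> - lam) * S) \<le> \<theta> * ((\<rho> - lam) * s)" using \<rho> \<theta> False by (intro mult_left_mono) auto
        then show ?thesis using far by (simp add: algebra_simps)
      qed
      finally show ?thesis using c by (simp add: mult_left_mono)
    qed
    then show "(\<integral>u. f u \<partial>P x) - (\<integral>u. f u \<partial>P y) \<le> \<rho> * c * (2 + \<theta> * V x + \<theta> * V y)"
      by (simp add: s_def algebra_simps)
  qed
  \<comment> \<open>The oscillation bound at scale \<open>1 / \<theta>\<close>, integrated in its
    second argument against \<open>N\<close>; the constant part is absorbed into \<open>V x\<close>
    because V \<ge> 1.\<close>
  define C where "C = (2 + \<theta> * (\<integral>y. V y \<partial>N)) / \<theta> + 1"
  have NV: "0 \<le> (\<integral>y. V y \<partial>N)" using V_nonneg by (simp add: integral_nonneg_AE)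
  have C: "0 \<le> C" using NV \<theta> by (simp add: C_def)
  interpret N: prob_space N using N by (simp add: admissible_def)
  have half: "(\<integral>y. f y \<partial>kernel_iter P k x) - (\<integral>y. f y \<partial>N) \<le> C * \<rho> ^ k * V x"
    if f: "f \<in> borel_measurable borel" "\<And>x. \<bar>f x\<bar> \<le> V x" for f x k
  proof -
    have vf: "V_bounded f" using f by (auto simp: V_bounded_def intro!: exI[of _ 1])
    have "osc_le \<theta> (1 / \<theta>) f" unfolding osc_le_def
    proof (intro conjI allI vf)
      fix x y
      have "f x - f y \<le> V x + V y" using f(2)[of x] f(2)[of y] by linarith
      also have "\<dots> \<le> 1 / \<theta> * (2 + \<theta> * V x + \<theta> * V y)" using \<theta> by (simp add: field_simps)
      finally show "f x - f y \<le> 1 / \<theta> * (2 + \<theta> * V x + \<theta> * V y)" .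
    qed
    then have osc: "osc_le \<theta> (\<rho> ^ k * (1 / \<theta>)) (\<lambda>x. \<integral>y. f y \<partial>kernel_iter P k x)"
      using \<theta> \<rho> contr by (intro osc_iter) auto
    define F where "F x = (\<integral>y. f y \<partial>kernel_iter P k x)" for x
    define a where "a = \<rho> ^ k * (1 / \<theta>)"
    have F: "V_bounded F" "\<And>y. F x - F y \<le> a * (2 + \<theta> * V x + \<theta> * V y)"
      using osc by (auto simp: osc_le_def F_def[abs_def] a_def)
    have int: "integrable N F" "integrable N V" using N(1) F(1) integrable_V_bounded V_bounded_V by auto
    have "F x - (\<integral>y. F y \<partial>N) = (\<integral>y. F x - F y \<partial>N)"
      using int by (simp add: N.prob_space)
    also have "\<dots> \<le> (\<integral>y. a * (2 + \<theta> * V x + \<theta> * V y) \<partial>N)"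
      using int F(2) by (intro integral_mono) auto
    also have "\<dots> = a * (2 + \<theta> * V x + \<theta> * (\<integral>y. V y \<partial>N))"
      using int by (simp add: N.prob_space)
    also have "\<dots> = \<rho> ^ k * ((2 + \<theta> * (\<integral>y. V y \<partial>N)) / \<theta> * 1 + V x)"
      using \<theta> by (simp add: a_def field_simps)
    also have "\<dots> \<le> \<rho> ^ k * ((2 + \<theta> * (\<integral>y. V y \<partial>N)) / \<theta> * V x + V x)"
      using \<rho> \<theta> NV V_ge_1[of x] by (intro mult_left_mono add_right_mono) auto
    also have "\<dots> = C * \<rho> ^ k * V x" by (simp add: C_def algebra_simps)
    also have "(\<integral>y. F y \<partial>N) = (\<integral>y. f y \<partial>N)"
      unfolding F_def by (intro integral_iter_invariant N vf)
    finally show ?thesis by (simp add: F_def)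
  qed
  show thesis
  proof (rule that[OF C \<rho>(5,4)])
    fix f :: "'a \<Rightarrow> real" and x k
    assume f: "f \<in> borel_measurable borel" "\<And>x. \<bar>f x\<bar> \<le> V x"
    show "\<bar>(\<integral>y. f y \<partial>kernel_iter P k x) - (\<integral>y. f y \<partial>N)\<bar> \<le> C * \<rho> ^ k * V x"
      using half[OF f, of k x] half[of "\<lambda>x. - f x" k x] f by (simp add: abs_le_iff)
  qed
qed

end

section \<open>The MALA kernel\<close>

text \<open>The integrand is dominated by \<open>1 / l\<close> times the sum of the exponential
  density and its reflection, each of mass 1.\<close>

lemma nn_integral_exp_neg_abs_finite:
  assumes "0 < l"
  shows "(\<integral>\<^sup>+t. ennreal (exp (- l * \<bar>t\<bar>)) \<partial>lborel) < \<infinity>"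
proof -
  define E where "E = exponential_density l"
  have E[measurable]: "E \<in> borel_measurable borel" by (simp add: E_def)
  interpret prob_space "density lborel E" unfolding E_def by (rule prob_space_exponential_density[OF assms])
  have 1: "(\<integral>\<^sup>+t. ennreal (E t) \<partial>lborel) = 1"
    using emeasure_space_1 by (simp add: emeasure_density)
  have 2: "(\<integral>\<^sup>+t. ennreal (E (- t)) \<partial>lborel) = 1"
    using nn_integral_real_affine[of "\<lambda>t. ennreal (E t)" "-1" 0] 1 by simp
  have "(\<integral>\<^sup>+t. ennreal (exp (- l * \<bar>t\<bar>)) \<partial>lborel) \<le> (\<integral>\<^sup>+t. ennreal (1 / l) * (ennreal (E t) + ennreal (E (- t))) \<partial>lborel)"
  proof (intro nn_integral_mono)
    fix t
    have nn: "0 \<le> E t" "0 \<le> E (- t)" using assms by (auto simp: E_def exponential_density_nonneg)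
    have "l * exp (- l * \<bar>t\<bar>) \<le> E t + E (- t)"
      using assms by (auto simp: E_def exponential_density_def mult.commute abs_if)
    then have "exp (- l * \<bar>t\<bar>) \<le> 1 / l * (E t + E (- t))" using assms by (simp add: field_simps)
    then show "ennreal (exp (- l * \<bar>t\<bar>)) \<le> ennreal (1 / l) * (ennreal (E t) + ennreal (E (- t)))"
      using nn assms by (simp add: ennreal_mult[symmetric] ennreal_plus[symmetric] ennreal_leI del: ennreal_plus)
  qed
  also have "\<dots> = ennreal (1 / l) * ((\<integral>\<^sup>+t. ennreal (E t) \<partial>lborel) + (\<integral>\<^sup>+t. ennreal (E (- t)) \<partial>lborel))"
    by (simp add: nn_integral_cmult nn_integral_add)
  also have "\<dots> < \<infinity>" unfolding 1 2 by (simp add: ennreal_mult_less_top)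
  finally show ?thesis .
qed

text \<open>The norm dominates the average of the absolute coordinates, so the integrand is below a
  product of one-dimensional exponentials.\<close>

lemma nn_integral_exp_neg_norm_finite:
  "(\<integral>\<^sup>+(x::'a::euclidean_space). ennreal (exp (- norm x)) \<partial>lborel) < \<infinity>"
proof -
  define l where "l = 1 / real DIM('a)"
  have l: "l > 0" by (simp add: l_def)
  have "(\<integral>\<^sup>+(x::'a). ennreal (exp (- norm x)) \<partial>lborel) \<le> (\<integral>\<^sup>+(x::'a). (\<Prod>b\<in>Basis. ennreal (exp (- l * \<bar>x \<bullet> b\<bar>))) \<partial>lborel)"
  proof (intro nn_integral_mono)
    fix x :: 'a
    have "(\<Sum>b\<in>Basis. \<bar>x \<bullet> b\<bar>) \<le> (\<Sum>b\<in>(Basis::'a set). norm x)" by (intro sum_mono Basis_le_norm)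
    then have "l * (\<Sum>b\<in>Basis. \<bar>x \<bullet> b\<bar>) \<le> norm x" by (simp add: l_def field_simps)
    then have "exp (- norm x) \<le> (\<Prod>b\<in>Basis. exp (- l * \<bar>x \<bullet> b\<bar>))"
      by (simp add: exp_sum[symmetric] sum_negf sum_distrib_left)
    then show "ennreal (exp (- norm x)) \<le> (\<Prod>b\<in>Basis. ennreal (exp (- l * \<bar>x \<bullet> b\<bar>)))"
      by (simp add: prod_ennreal ennreal_leI)
  qed
  also have "\<dots> = (\<Prod>b\<in>(Basis::'a set). \<integral>\<^sup>+t. ennreal (exp (- l * \<bar>t\<bar>)) \<partial>lborel)"
    by (rule nn_integral_lborel_prod) auto
  also have "\<dots> < \<infinity>"
    using nn_integral_exp_neg_abs_finite[OF l] by (simp add: power_less_top_ennreal)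
  finally show ?thesis .
qed

lemma nn_integral_lborel_translate:
  fixes f :: "'a::euclidean_space \<Rightarrow> ennreal"
  assumes [measurable]: "f \<in> borel_measurable borel"
  shows "(\<integral>\<^sup>+y. f (y - c) \<partial>lborel) = (\<integral>\<^sup>+y. f y \<partial>lborel)"
proof -
  have "(\<integral>\<^sup>+y. f y \<partial>lborel) = (\<integral>\<^sup>+y. f y \<partial>distr lborel borel ((+) (- c)))"
    by (simp only: lborel_distr_plus)
  also have "\<dots> = (\<integral>\<^sup>+y. f (y - c) \<partial>lborel)"
    by (subst nn_integral_distr) auto
  finally show ?thesis by simp
qed

section \<open>The Gaussian proposal density\<close>

lemma prop_dens_pos: "0 < \<gamma> \<Longrightarrow> 0 < prop_dens gU \<gamma> x y"
  by (simp add: prop_dens_def)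

lemma prop_dens_eq_prod_normal_density:
  fixes x y :: "'a::euclidean_space"
  assumes "0 < \<gamma>"
  shows "prop_dens gU \<gamma> x y = (\<Prod>b\<in>Basis. normal_density ((x - \<gamma> *\<^sub>R gU x) \<bullet> b) (sqrt (2 * \<gamma>)) (y \<bullet> b))"
proof -
  have "(\<Prod>b\<in>Basis. normal_density ((x - \<gamma> *\<^sub>R gU x) \<bullet> b) (sqrt (2 * \<gamma>)) (y \<bullet> b))
    = (\<Prod>b\<in>(Basis::'a set). 1 / sqrt (4 * pi * \<gamma>)) * exp (\<Sum>b\<in>Basis. - ((y - x + \<gamma> *\<^sub>R gU x) \<bullet> b)\<^sup>2 / (4 * \<gamma>))"
    using assms by (simp add: normal_density_def exp_sum prod_dividef power_one_over inner_simps algebra_simps)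
  also have "(\<Sum>b\<in>Basis. - ((y - x + \<gamma> *\<^sub>R gU x) \<bullet> b)\<^sup>2 / (4 * \<gamma>)) = - (norm (y - x + \<gamma> *\<^sub>R gU x))\<^sup>2 / (4 * \<gamma>)"
    unfolding power2_norm_eq_inner euclidean_inner[of "y - x + \<gamma> *\<^sub>R gU x" "y - x + \<gamma> *\<^sub>R gU x"]
    by (simp only: sum_divide_distrib sum_negf[symmetric] power2_eq_square)
  also have "(\<Prod>b\<in>(Basis::'a set). 1 / sqrt (4 * pi * \<gamma>)) = (4 * pi * \<gamma>) powr (- real DIM('a) / 2)"
    using assms by (simp add: powr_half_sqrt[symmetric] power_divide powr_minus_divide powr_power)
  finally show ?thesis by (simp add: prop_dens_def)
qed

lemma nn_integral_prop_dens:
  fixes x :: "'a::euclidean_space"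
  assumes "0 < \<gamma>"
  shows "(\<integral>\<^sup>+y. ennreal (prop_dens gU \<gamma> x y) \<partial>lborel) = 1"
proof -
  have s: "0 < sqrt (2 * \<gamma>)" using assms by simp
  have "(\<integral>\<^sup>+y. ennreal (prop_dens gU \<gamma> x y) \<partial>lborel)
    = (\<integral>\<^sup>+y. (\<Prod>b\<in>Basis. ennreal (normal_density ((x - \<gamma> *\<^sub>R gU x) \<bullet> b) (sqrt (2 * \<gamma>)) (y \<bullet> b))) \<partial>lborel)"
    by (simp add: prop_dens_eq_prod_normal_density[OF assms] prod_ennreal)
  also have "\<dots> = (\<Prod>b\<in>Basis. \<integral>\<^sup>+t. ennreal (normal_density ((x - \<gamma> *\<^sub>R gU x) \<bullet> b) (sqrt (2 * \<gamma>)) t) \<partial>lborel)"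
    by (rule nn_integral_lborel_prod) auto
  also have "\<dots> = 1"
    using integral_normal_density[OF s] integrable_normal_density[OF s]
    by (simp add: nn_integral_eq_integral)
  finally show ?thesis .
qed

lemma sqrt_one_plus_le: "sqrt (1 + (norm (x::'a::real_normed_vector))\<^sup>2) \<le> 1 + norm x"
  by (rule real_le_lsqrt) (auto simp: power2_eq_square algebra_simps)

lemma norm_le_sqrt_one_plus: "norm (x::'a::real_normed_vector) \<le> sqrt (1 + (norm x)\<^sup>2)"
  by (rule real_le_rsqrt) auto

text \<open>The weight at \<open>y\<close> is at most its value near the proposal mean times an
  exponential of the distance to the mean, and the Gaussian absorbs that exponential uniformly in
  \<open>x\<close>.\<close>

lemma prop_dens_exp_moment:
  fixes gU :: "'a::euclidean_space \<Rightarrow> 'a"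
  assumes \<gamma>: "0 < \<gamma>" and \<eta>: "0 \<le> \<eta>"
  shows "\<exists>D\<ge>0. \<forall>x. (\<integral>\<^sup>+y. ennreal (exp (\<eta> * sqrt (1 + (norm y)\<^sup>2))) * ennreal (prop_dens gU \<gamma> x y) \<partial>lborel)
      \<le> ennreal (D * exp (\<eta> * norm (x - \<gamma> *\<^sub>R gU x)))"
proof -
  define c0 where "c0 = (4 * pi * \<gamma>) powr (- real DIM('a) / 2)"
  define I where "I = enn2real (\<integral>\<^sup>+(w::'a). ennreal (exp (- norm w)) \<partial>lborel)"
  have I: "(\<integral>\<^sup>+(w::'a). ennreal (exp (- norm w)) \<partial>lborel) = ennreal I"
    using nn_integral_exp_neg_norm_finite by (simp add: I_def ennreal_enn2real_if less_top)
  define D where "D = exp \<eta> * c0 * exp (\<gamma> * (\<eta> + 1)\<^sup>2) * I"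
  have "(\<integral>\<^sup>+y. ennreal (exp (\<eta> * sqrt (1 + (norm y)\<^sup>2))) * ennreal (prop_dens gU \<gamma> x y) \<partial>lborel)
      \<le> ennreal (D * exp (\<eta> * norm (x - \<gamma> *\<^sub>R gU x)))" for x
  proof -
    define c where "c = x - \<gamma> *\<^sub>R gU x"
    define k where "k = exp \<eta> * exp (\<eta> * norm c) * c0 * exp (\<gamma> * (\<eta> + 1)\<^sup>2)"
    have k_nonneg: "0 \<le> k" by (simp add: k_def c0_def)
    have "(\<integral>\<^sup>+y. ennreal (exp (\<eta> * sqrt (1 + (norm y)\<^sup>2))) * ennreal (prop_dens gU \<gamma> x y) \<partial>lborel)
      \<le> (\<integral>\<^sup>+y. ennreal k * ennreal (exp (- norm (y - c))) \<partial>lborel)"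
    proof (intro nn_integral_mono)
      fix y
      define s where "s = norm (y - c)"
      have pd: "prop_dens gU \<gamma> x y = c0 * exp (- s\<^sup>2 / (4 * \<gamma>))"
        by (simp add: prop_dens_def c0_def s_def c_def algebra_simps)
      have "norm y \<le> norm c + s" using norm_triangle_ineq[of c "y - c"] by (simp add: s_def)
      then have "sqrt (1 + (norm y)\<^sup>2) \<le> 1 + norm c + s" using sqrt_one_plus_le[of y] by linarith
      then have 1: "\<eta> * sqrt (1 + (norm y)\<^sup>2) \<le> \<eta> * (1 + norm c + s)" using \<eta> by (intro mult_left_mono) auto
      \<comment> \<open>Completing the square with \<eta> + 1 instead of \<eta> leaves the
        integrable factor exp(-s).\<close>
      have 2: "\<eta> * s - s\<^sup>2 / (4 * \<gamma>) \<le> \<gamma> * (\<eta> + 1)\<^sup>2 - s"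
      proof -
        have "0 \<le> (s - 2 * \<gamma> * (\<eta> + 1))\<^sup>2 / (4 * \<gamma>)" using \<gamma> by simp
        also have "\<dots> = s\<^sup>2 / (4 * \<gamma>) - (\<eta> + 1) * s + \<gamma> * (\<eta> + 1)\<^sup>2"
          using \<gamma> by (simp add: power2_eq_square field_simps)
        finally show ?thesis by (simp add: algebra_simps)
      qed
      have "exp (\<eta> * sqrt (1 + (norm y)\<^sup>2)) * exp (- s\<^sup>2 / (4 * \<gamma>)) \<le> exp (\<eta> + \<eta> * norm c + \<gamma> * (\<eta> + 1)\<^sup>2 - s)"
        unfolding exp_add[symmetric] using 1 2 by (simp add: algebra_simps)
      then have "c0 * (exp (\<eta> * sqrt (1 + (norm y)\<^sup>2)) * exp (- s\<^sup>2 / (4 * \<gamma>))) \<le> c0 * exp (\<eta> + \<eta> * norm c + \<gamma> * (\<eta> + 1)\<^sup>2 - s)"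
        by (intro mult_left_mono) (auto simp: c0_def)
      then have "exp (\<eta> * sqrt (1 + (norm y)\<^sup>2)) * prop_dens gU \<gamma> x y \<le> k * exp (- s)"
        by (simp add: pd k_def exp_add exp_diff exp_minus field_simps)
      then show "ennreal (exp (\<eta> * sqrt (1 + (norm y)\<^sup>2))) * ennreal (prop_dens gU \<gamma> x y) \<le> ennreal k * ennreal (exp (- norm (y - c)))"
        using prop_dens_pos[OF \<gamma>, of gU x y]
        by (simp add: ennreal_mult[symmetric] s_def ennreal_leI less_imp_le k_nonneg)
    qed
    also have "\<dots> = ennreal k * ennreal I"
      using nn_integral_lborel_translate[of "\<lambda>w. ennreal (exp (- norm w))" c] by (simp add: nn_integral_cmult I)
    also have "\<dots> = ennreal (D * exp (\<eta> * norm (x - \<gamma> *\<^sub>R gU x)))"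
      using k_nonneg by (subst ennreal_mult[symmetric]) (simp_all add: I_def D_def k_def c_def mult_ac)
    finally show ?thesis .
  qed
  moreover have "0 \<le> D" by (simp add: D_def I_def c0_def)
  ultimately show ?thesis by blast
qed

section \<open>The MALA transition kernel\<close>

locale mala_setup =
  fixes U :: "'a::euclidean_space \<Rightarrow> real" and gU :: "'a \<Rightarrow> 'a" and \<gamma> :: real
  assumes U_cont: "continuous_on UNIV U" and gU_cont: "continuous_on UNIV gU"
    and Z_integrable: "integrable lborel (\<lambda>x. exp (- U x))" and \<gamma>_pos: "0 < \<gamma>"
begin

abbreviation "acc \<equiv> accept U gU \<gamma>"
abbreviation "r \<equiv> prop_dens gU \<gamma>"
abbreviation "P \<equiv> MALA U gU \<gamma>"

lemma U_measurable[measurable]: "U \<in> borel_measurable borel"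
  by (rule borel_measurable_continuous_onI[OF U_cont])

lemma gU_measurable[measurable]: "gU \<in> borel_measurable borel"
  by (rule borel_measurable_continuous_onI[OF gU_cont])

lemma norm_const_pos: "0 < norm_const U"
proof -
  have "(\<integral>x. exp (- U x) \<partial>lborel) \<noteq> 0"
  proof
    assume "(\<integral>x. exp (- U x) \<partial>lborel) = 0"
    then have "AE x in lborel. exp (- U x) = 0"
      using integral_nonneg_eq_0_iff_AE[OF Z_integrable] by simp
    then have "ae_filter (lborel :: 'a measure) = bot" by (simp only: exp_not_eq_zero eventually_False)
    then show False by (simp only: ae_filter_eq_bot_iff) simp
  qed
  moreover have "0 \<le> (\<integral>x. exp (- U x) \<partial>lborel)" by (simp add: integral_nonneg_AE)
  ultimately show ?thesis unfolding norm_const_def by linarith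
qed

lemma pi_dens_pos: "0 < pi_dens U x"
  using norm_const_pos by (simp add: pi_dens_def)

lemma r_pos: "0 < r x y"
  by (rule prop_dens_pos[OF \<gamma>_pos])

lemma acc_pos: "0 < acc x y" and acc_le_1: "acc x y \<le> 1"
  using pi_dens_pos r_pos by (auto simp: accept_def)

text \<open>The normalising constants cancel. In this form continuity and measurability are
  immediate and the exponent is the one bounded in \<open>log_ratio_lower_bound\<close>.\<close>

lemma acc_eq_exp:
  "acc x y = min 1 (exp (U x - U y + ((norm (y - x + \<gamma> *\<^sub>R gU x))\<^sup>2 - (norm (x - y + \<gamma> *\<^sub>R gU y))\<^sup>2) / (4 * \<gamma>)))"
proof -
  have cancel: "(a / Z * (c * b)) / (a' / Z * (c * b')) = (a * b) / (a' * b')" if "Z \<noteq> 0" "c \<noteq> 0" for a b a' b' c Z :: real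
    using that by simp
  show ?thesis
    unfolding accept_def pi_dens_def prop_dens_def
    using norm_const_pos \<gamma>_pos by (subst cancel) (auto simp: exp_add[symmetric] exp_diff[symmetric] diff_divide_distrib algebra_simps)
qed

text \<open>Multiplying the minimum out gives the smaller of the two flows
  \<open>pi_dens U x * r x y\<close> and \<open>pi_dens U y * r y x\<close>, which is
  symmetric.\<close>

lemma detailed_balance: "pi_dens U x * (acc x y * r x y) = pi_dens U y * (acc y x * r y x)"
proof -
  have "pi_dens U x * (acc x y * r x y) = min (pi_dens U x * r x y) (pi_dens U y * r y x)" for x y
    using pi_dens_pos[of x] r_pos[of x y] by (simp add: accept_def min_def field_simps)
  then show ?thesis by (metis min.commute)
qed

lemma pi_dens_measurable[measurable]: "pi_dens U \<in> borel_measurable borel"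
  unfolding pi_dens_def by measurable

lemma r_measurable[measurable (raw)]:
  assumes [measurable]: "f \<in> M \<rightarrow>\<^sub>M borel" "g \<in> M \<rightarrow>\<^sub>M borel"
  shows "(\<lambda>p. r (f p) (g p)) \<in> borel_measurable M"
  unfolding prop_dens_def by measurable

lemma acc_measurable[measurable (raw)]:
  assumes [measurable]: "f \<in> M \<rightarrow>\<^sub>M borel" "g \<in> M \<rightarrow>\<^sub>M borel"
  shows "(\<lambda>p. acc (f p) (g p)) \<in> borel_measurable M"
  unfolding acc_eq_exp by measurable

definition rej :: "'a \<Rightarrow> ennreal" where
  "rej x = (\<integral>\<^sup>+ y. ennreal ((1 - acc x y) * r x y) \<partial>lborel)"

lemma rej_measurable[measurable]: "rej \<in> borel_measurable borel"
  unfolding rej_def by measurable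

lemma sets_MALA[simp, measurable_cong]: "sets (P x) = sets borel"
proof -
  have "sets (P x) = sigma_sets UNIV (sets (borel :: 'a measure))"
    unfolding MALA_def by (rule sets_measure_of) simp
  then show ?thesis using sets.sigma_sets_eq[of "borel :: 'a measure"] by simp
qed

lemma space_MALA[simp]: "space (P x) = UNIV"
  using sets_eq_imp_space_eq[OF sets_MALA, of x] by simp

text \<open>\<open>measure_of\<close> returns the given set function only if it is a measure and
  defaults to zero otherwise, so countable additivity has to be established first.\<close>

lemma emeasure_MALA:
  assumes A: "A \<in> sets borel"
  shows "emeasure (P x) A = (\<integral>\<^sup>+ y. indicator A y * ennreal (acc x y * r x y) \<partial>lborel) + indicator A x * rej x"
proof -
  define \<mu> where "\<mu> A = (\<integral>\<^sup>+ y. indicator A y * ennreal (acc x y * r x y) \<partial>lborel) + indicator A x * rej x" for A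
  have "emeasure (measure_of UNIV (sets borel) \<mu>) A = \<mu> A"
  proof (rule emeasure_measure_of_sigma)
    show "sigma_algebra UNIV (sets (borel :: 'a measure))"
      using sets.sigma_algebra_axioms[of "borel :: 'a measure"] by simp
    show "positive (sets borel) \<mu>" by (simp add: positive_def \<mu>_def)
    show "countably_additive (sets borel) \<mu>"
      unfolding countably_additive_def
    proof (intro allI impI)
      fix B :: "nat \<Rightarrow> 'a set" assume B: "range B \<subseteq> sets borel" "disjoint_family B"
      have [measurable]: "B i \<in> sets borel" for i using B by auto
      have ind: "(\<Sum>i. indicator (B i) y :: ennreal) = indicator (\<Union>i. B i) y" for y
        using suminf_indicator[OF B(2)] .
      have "(\<Sum>i. \<mu> (B i)) = (\<Sum>i. \<integral>\<^sup>+ y. indicator (B i) y * ennreal (acc x y * r x y) \<partial>lborel) + (\<Sum>i. indicator (B i) x * rej x)"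
        unfolding \<mu>_def by (intro suminf_add[symmetric] summableI)
      also have "(\<Sum>i. \<integral>\<^sup>+ y. indicator (B i) y * ennreal (acc x y * r x y) \<partial>lborel)
          = (\<integral>\<^sup>+ y. (\<Sum>i. indicator (B i) y * ennreal (acc x y * r x y)) \<partial>lborel)"
        by (intro nn_integral_suminf[symmetric]) measurable
      finally show "(\<Sum>i. \<mu> (B i)) = \<mu> (\<Union>i. B i)"
        by (simp add: ennreal_suminf_multc ind \<mu>_def)
    qed
  qed (rule A)
  then show ?thesis by (simp add: MALA_def \<mu>_def[abs_def] rej_def)
qed

lemma nn_integral_MALA:
  assumes "f \<in> borel_measurable borel"
  shows "(\<integral>\<^sup>+y. f y \<partial>P x) = (\<integral>\<^sup>+ y. f y * ennreal (acc x y * r x y) \<partial>lborel) + f x * rej x"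
  using assms
proof (induction rule: borel_measurable_induct)
  case (cong f g)
  then have "f = g" by (simp add: fun_eq_iff)
  then show ?case using cong by simp
next
  case (set A)
  then show ?case by (simp add: emeasure_MALA)
next
  case (mult u c)
  then show ?case by (simp add: nn_integral_cmult distrib_left mult.assoc)
next
  case (add u v)
  then show ?case by (simp add: nn_integral_add distrib_right ac_simps)
next
  case (seq F)
  note [measurable] = seq(1)
  have inc: "incseq F" by fact
  have "(\<integral>\<^sup>+y. (SUP i. F i) y \<partial>P x) = (\<integral>\<^sup>+y. (SUP i. F i y) \<partial>P x)" by (simp only: SUP_apply)
  also have "\<dots> = (SUP i. \<integral>\<^sup>+y. F i y \<partial>P x)"
    by (rule nn_integral_monotone_convergence_SUP[OF inc]) measurable
  also have "\<dots> = (SUP i. (\<integral>\<^sup>+ y. F i y * ennreal (acc x y * r x y) \<partial>lborel) + F i x * rej x)"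
    by (simp add: seq)
  also have "\<dots> = (SUP i. \<integral>\<^sup>+ y. F i y * ennreal (acc x y * r x y) \<partial>lborel) + (SUP i. F i x * rej x)"
    using inc by (intro ennreal_SUP_add) (auto simp: incseq_def le_fun_def intro!: nn_integral_mono mult_right_mono)
  also have "(SUP i. \<integral>\<^sup>+ y. F i y * ennreal (acc x y * r x y) \<partial>lborel) = (\<integral>\<^sup>+ y. (SUP i. F i y * ennreal (acc x y * r x y)) \<partial>lborel)"
    using inc by (intro nn_integral_monotone_convergence_SUP[symmetric]) (auto simp: incseq_def le_fun_def intro!: mult_right_mono)
  finally show ?case by (simp only: SUP_mult_right_ennreal[symmetric] SUP_apply)
qed

lemma nn_integral_acc_plus_rej: "(\<integral>\<^sup>+ y. ennreal (acc x y * r x y) \<partial>lborel) + rej x = 1"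
proof -
  have "(\<integral>\<^sup>+ y. ennreal (acc x y * r x y) \<partial>lborel) + rej x
      = (\<integral>\<^sup>+ y. ennreal (acc x y * r x y) + ennreal ((1 - acc x y) * r x y) \<partial>lborel)"
    unfolding rej_def by (intro nn_integral_add[symmetric]) measurable
  also have "\<dots> = (\<integral>\<^sup>+ y. ennreal (r x y) \<partial>lborel)"
    using acc_pos[of x] acc_le_1[of x] r_pos[of x]
    by (intro nn_integral_cong) (auto simp: ennreal_plus[symmetric] less_imp_le algebra_simps simp del: ennreal_plus)
  finally show ?thesis by (simp add: nn_integral_prop_dens[OF \<gamma>_pos])
qed

lemma prob_space_MALA: "prob_space (P x)"
  by (rule prob_spaceI) (simp add: emeasure_MALA nn_integral_acc_plus_rej)

lemma MALA_measurable: "P \<in> borel \<rightarrow>\<^sub>M prob_algebra borel"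
proof (rule measurable_prob_algebraI)
  show "P \<in> borel \<rightarrow>\<^sub>M subprob_algebra borel"
  proof (rule measurable_subprob_algebra)
    fix A :: "'a set" assume A[measurable]: "A \<in> sets borel"
    show "(\<lambda>x. emeasure (P x) A) \<in> borel_measurable borel"
      unfolding emeasure_MALA[OF A] by measurable
  qed (auto intro: prob_space_imp_subprob_space prob_space_MALA)
qed (rule prob_space_MALA)

section \<open>Invariance of the target\<close>

lemma sets_pi_meas[simp, measurable_cong]: "sets (pi_meas U) = sets borel"
  by (simp add: pi_meas_def)

lemma prob_space_pi_meas: "prob_space (pi_meas U)"
proof (rule prob_spaceI)
  have "(\<integral>\<^sup>+x. ennreal (pi_dens U x) \<partial>lborel) = ennreal (\<integral>x. pi_dens U x \<partial>lborel)"
    using Z_integrable norm_const_pos by (intro nn_integral_eq_integral) (auto simp: pi_dens_def)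
  also have "\<dots> = 1" using norm_const_pos by (simp add: pi_dens_def norm_const_def)
  finally show "emeasure (pi_meas U) (space (pi_meas U)) = 1"
    by (simp add: pi_meas_def emeasure_density)
qed

text \<open>The accepted flow \<open>q\<close> is symmetric, so exchanging the order of integration
  moves the indicator of \<open>A\<close> from the end point to the starting point; together with
  the rejected mass, which stays put, the total outflow of each point is its density.\<close>

lemma pi_meas_invariant: "pi_meas U \<bind> P = pi_meas U"
proof (rule measure_eqI)
  interpret pi: prob_space "pi_meas U" by (rule prob_space_pi_meas)
  have P: "P \<in> pi_meas U \<rightarrow>\<^sub>M subprob_algebra borel"
    using measurable_prob_algebraD[OF MALA_measurable] by (simp add: measurable_cong_sets[OF sets_pi_meas refl])
  show sets: "sets (pi_meas U \<bind> P) = sets (pi_meas U)"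
    using pi.not_empty by (subst sets_bind[where N=borel]) auto
  fix A assume "A \<in> sets (pi_meas U \<bind> P)"
  then have A[measurable]: "A \<in> sets borel" using sets by simp
  define q where "q x y = ennreal (pi_dens U x * (acc x y * r x y))" for x y
  have q_sym: "q x y = q y x" for x y unfolding q_def by (simp only: detailed_balance)
  have q_meas[measurable]: "(\<lambda>p. q (fst p) (snd p)) \<in> borel_measurable (borel \<Otimes>\<^sub>M borel)" unfolding q_def by measurable
  have q_meas'[measurable]: "q x \<in> borel_measurable borel" for x unfolding q_def[abs_def] by measurable
  have "emeasure (pi_meas U \<bind> P) A = (\<integral>\<^sup>+x. emeasure (P x) A \<partial>pi_meas U)"
    by (rule emeasure_bind[OF pi.not_empty P A])
  also have "\<dots> = (\<integral>\<^sup>+x. ennreal (pi_dens U x) * emeasure (P x) A \<partial>lborel)"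
    unfolding pi_meas_def emeasure_MALA[OF A] by (intro nn_integral_density) measurable
  also have "\<dots> = (\<integral>\<^sup>+x. (\<integral>\<^sup>+y. indicator A y * q x y \<partial>lborel) + indicator A x * (ennreal (pi_dens U x) * rej x) \<partial>lborel)"
  proof (intro nn_integral_cong)
    fix x
    have "ennreal (pi_dens U x) * (\<integral>\<^sup>+y. indicator A y * ennreal (acc x y * r x y) \<partial>lborel)
        = (\<integral>\<^sup>+y. ennreal (pi_dens U x) * (indicator A y * ennreal (acc x y * r x y)) \<partial>lborel)"
      by (intro nn_integral_cmult[symmetric]) measurable
    also have "\<dots> = (\<integral>\<^sup>+y. indicator A y * q x y \<partial>lborel)"
      using pi_dens_pos[of x] by (intro nn_integral_cong) (simp add: q_def ennreal_mult' less_imp_le ac_simps)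
    finally show "ennreal (pi_dens U x) * emeasure (P x) A
        = (\<integral>\<^sup>+y. indicator A y * q x y \<partial>lborel) + indicator A x * (ennreal (pi_dens U x) * rej x)"
      by (simp add: emeasure_MALA[OF A] distrib_left ac_simps)
  qed
  also have "\<dots> = (\<integral>\<^sup>+x. (\<integral>\<^sup>+y. indicator A y * q x y \<partial>lborel) \<partial>lborel) + (\<integral>\<^sup>+x. indicator A x * (ennreal (pi_dens U x) * rej x) \<partial>lborel)"
    by (intro nn_integral_add) (auto simp: q_def)
  also have "(\<integral>\<^sup>+x. (\<integral>\<^sup>+y. indicator A y * q x y \<partial>lborel) \<partial>lborel) = (\<integral>\<^sup>+y. (\<integral>\<^sup>+x. indicator A y * q x y \<partial>lborel) \<partial>lborel)"
    by (rule lborel_pair.Fubini') (simp add: q_def split_beta')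
  also have "\<dots> = (\<integral>\<^sup>+x. indicator A x * (\<integral>\<^sup>+y. q x y \<partial>lborel) \<partial>lborel)"
    by (intro nn_integral_cong) (subst q_sym, simp add: nn_integral_cmult)
  also have "\<dots> + (\<integral>\<^sup>+x. indicator A x * (ennreal (pi_dens U x) * rej x) \<partial>lborel)
      = (\<integral>\<^sup>+x. indicator A x * (\<integral>\<^sup>+y. q x y \<partial>lborel) + indicator A x * (ennreal (pi_dens U x) * rej x) \<partial>lborel)"
    by (intro nn_integral_add[symmetric]) (auto simp: q_def)
  also have "\<dots> = (\<integral>\<^sup>+x. ennreal (pi_dens U x) * indicator A x \<partial>lborel)"
  proof (intro nn_integral_cong)
    fix x
    have "(\<integral>\<^sup>+y. q x y \<partial>lborel) = ennreal (pi_dens U x) * (\<integral>\<^sup>+y. ennreal (acc x y * r x y) \<partial>lborel)"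
      unfolding q_def using pi_dens_pos[of x] by (subst nn_integral_cmult[symmetric]) (auto simp: ennreal_mult' less_imp_le)
    then have "(\<integral>\<^sup>+y. q x y \<partial>lborel) + ennreal (pi_dens U x) * rej x = ennreal (pi_dens U x)"
      using nn_integral_acc_plus_rej[of x] by (simp add: distrib_left[symmetric])
    then show "indicator A x * (\<integral>\<^sup>+y. q x y \<partial>lborel) + indicator A x * (ennreal (pi_dens U x) * rej x) = ennreal (pi_dens U x) * indicator A x"
      by (simp add: distrib_left[symmetric] mult.commute)
  qed
  also have "\<dots> = emeasure (pi_meas U) A" by (simp add: pi_meas_def emeasure_density)
  finally show "emeasure (pi_meas U \<bind> P) A = emeasure (pi_meas U) A" .
qed

section \<open>Minorization on balls\<close>

lemma acc_r_continuous: "continuous_on UNIV (\<lambda>p. acc (fst p) (snd p) * r (fst p) (snd p))"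
  unfolding acc_eq_exp prop_dens_def using \<gamma>_pos
  by (intro continuous_intros continuous_on_compose2[OF U_cont] continuous_on_compose2[OF gU_cont]) auto

text \<open>The density of the accepted part is continuous and positive, so it has a positive
  minimum over a compact product of balls; the atom at \<open>x\<close> is dropped. The unit ball
  merely supplies a fixed set of positive finite volume.\<close>

lemma minorization:
  "\<exists>\<epsilon>>0. \<epsilon> < 1 \<and> (\<forall>x A. norm x \<le> R \<longrightarrow> A \<in> sets borel \<longrightarrow>
     \<epsilon> * measure (uniform_measure lborel (cball 0 1)) A \<le> measure (P x) A)"
proof (cases "0 \<le> R")
  case False
  then have "\<not> norm (x::'a) \<le> R" for x using norm_ge_zero[of x] by linarith
  then show ?thesis by (intro exI[of _ "1/2"]) auto
next
  case True
  define S :: "('a \<times> 'a) set" where "S = cball 0 R \<times> cball 0 1"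
  have "compact S" unfolding S_def by (intro compact_Times compact_cball)
  moreover have "S \<noteq> {}" using True by (auto simp: S_def)
  ultimately have "\<exists>p\<in>S. \<forall>q\<in>S. acc (fst p) (snd p) * r (fst p) (snd p) \<le> acc (fst q) (snd q) * r (fst q) (snd q)"
    by (rule continuous_attains_inf[OF _ _ continuous_on_subset[OF acc_r_continuous subset_UNIV]])
  then obtain p where p: "p \<in> S" "\<And>q. q \<in> S \<Longrightarrow> acc (fst p) (snd p) * r (fst p) (snd p) \<le> acc (fst q) (snd q) * r (fst q) (snd q)"
    by blast
  define \<delta> where "\<delta> = acc (fst p) (snd p) * r (fst p) (snd p)"
  have \<delta>: "0 < \<delta>" using acc_pos r_pos by (simp add: \<delta>_def)
  define v where "v = measure lborel (cball (0::'a) 1)"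
  have v: "0 < v" "emeasure lborel (cball (0::'a) 1) = ennreal v"
    unfolding v_def by (simp, intro emeasure_eq_ennreal_measure) (simp add: emeasure_cball)
  \<comment> \<open>The volume \<open>v\<close> converts the uniform law into Lebesgue measure; the
    cap 1/2 keeps \<epsilon> strictly below 1.\<close>
  define \<epsilon> where "\<epsilon> = min (\<delta> * v) (1/2)"
  have \<epsilon>: "0 < \<epsilon>" "\<epsilon> < 1" "\<epsilon> \<le> \<delta> * v" using \<delta> v by (auto simp: \<epsilon>_def)
  have "\<epsilon> * measure (uniform_measure lborel (cball 0 1)) A \<le> measure (P x) A"
    if x: "norm x \<le> R" and A[measurable]: "A \<in> sets borel" for x A
  proof -
    interpret X: prob_space "P x" by (rule prob_space_MALA)
    define a where "a = measure lborel (cball 0 1 \<inter> A)"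
    have "emeasure lborel (cball 0 1 \<inter> A) \<le> ennreal v"
      unfolding v(2)[symmetric] by (intro emeasure_mono) auto
    then have fin: "emeasure lborel (cball 0 1 \<inter> A) = ennreal a"
      unfolding a_def by (intro emeasure_eq_ennreal_measure) (auto simp: top_unique)
    have "ennreal (\<delta> * a) = (\<integral>\<^sup>+y. ennreal \<delta> * indicator (cball 0 1 \<inter> A) y \<partial>lborel)"
      using \<delta> by (subst nn_integral_cmult_indicator) (auto simp: fin ennreal_mult'' a_def)
    also have "\<dots> \<le> (\<integral>\<^sup>+ y. indicator A y * ennreal (acc x y * r x y) \<partial>lborel)"
    proof (intro nn_integral_mono)
      fix y show "ennreal \<delta> * indicator (cball 0 1 \<inter> A) y \<le> indicator A y * ennreal (acc x y * r x y)"
        using p(2)[of "(x, y)"] x by (auto simp: S_def \<delta>_def indicator_def intro!: ennreal_leI)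
    qed
    also have "\<dots> \<le> emeasure (P x) A" by (simp add: emeasure_MALA[OF A])
    finally have le: "\<delta> * a \<le> measure (P x) A" by (simp add: X.emeasure_eq_measure)
    have "measure (uniform_measure lborel (cball 0 1)) A = a / v"
      using v by (subst measure_uniform_measure) (auto simp: a_def v_def)
    then have "\<epsilon> * measure (uniform_measure lborel (cball 0 1)) A = \<epsilon> * a / v" by simp
    also have "\<dots> \<le> (\<delta> * v) * a / v" using \<epsilon> v by (intro divide_right_mono mult_right_mono) (auto simp: a_def)
    also have "\<dots> = \<delta> * a" using v by simp
    finally show ?thesis using le by linarith
  qed
  then show ?thesis using \<epsilon> by blast
qed

end

section \<open>Drift and geometric ergodicity\<close>

text \<open>Growth of \<open>U\<close> with slope \<eta> + 1 beats the weight and leaves exp(-|x|).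
  The case \<eta> = 0 makes the target normalisable; the general case gives it a finite moment of
  the weight.\<close>

lemma (in tail_convex_potential) exp_weight_integrable:
  assumes \<eta>: "0 \<le> \<eta>"
  shows "integrable lborel (\<lambda>x. exp (\<eta> * sqrt (1 + (norm x)\<^sup>2)) * exp (- U x))"
proof -
  have [measurable]: "U \<in> borel_measurable borel"
    by (rule borel_measurable_continuous_onI[OF U_continuous])
  obtain C where C: "\<And>x. (\<eta> + 1) * norm x - C \<le> U x" using U_superlinear by blast
  have exp_int: "integrable lborel (\<lambda>x::'a. exp (- norm x))"
    by (rule integrableI_nonneg) (use nn_integral_exp_neg_norm_finite in auto)
  show ?thesis
  proof (rule Bochner_Integration.integrable_bound)
    show "integrable lborel (\<lambda>x::'a. exp (\<eta> + C) * exp (- norm x))" using exp_int by simp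
    show "AE x in lborel. norm (exp (\<eta> * sqrt (1 + (norm x)\<^sup>2)) * exp (- U x)) \<le> norm (exp (\<eta> + C) * exp (- norm x))"
    proof (rule AE_I2)
      fix x :: 'a
      have "\<eta> * sqrt (1 + (norm x)\<^sup>2) \<le> \<eta> * (1 + norm x)" using \<eta> sqrt_one_plus_le by (intro mult_left_mono)
      then have "\<eta> * sqrt (1 + (norm x)\<^sup>2) + - U x \<le> (\<eta> + C) + - norm x" using C[of x] by (simp add: algebra_simps)
      then show "norm (exp (\<eta> * sqrt (1 + (norm x)\<^sup>2)) * exp (- U x)) \<le> norm (exp (\<eta> + C) * exp (- norm x))"
        unfolding exp_add[symmetric] by simp
    qed
  qed measurable
qed

section \<open>Drift condition and ergodicity for an arbitrary exponential weight\<close>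

locale mala_tail = tail_convex_potential +
  fixes \<gamma> \<eta> :: real
  assumes \<gamma>: "0 < \<gamma>" "\<gamma> \<le> 1/4" "\<gamma> * L \<le> 1/4" "\<gamma> * Lb\<^sup>2 \<le> m / 4"
    and \<eta>: "0 < \<eta>"
begin

sublocale mala_setup U gU \<gamma>
  using exp_weight_integrable[of 0] by unfold_locales (auto intro: U_continuous gU_continuous \<gamma>)

definition W :: "'a \<Rightarrow> real" where
  "W x = exp (\<eta> * sqrt (1 + (norm x)\<^sup>2))"

lemma W_measurable[measurable]: "W \<in> borel_measurable borel"
  unfolding W_def by measurable

lemma W_ge_exp_norm: "exp (\<eta> * norm x) \<le> W x"
  using \<eta> norm_le_sqrt_one_plus[of x] by (simp add: W_def)

lemma W_ge_1: "1 \<le> W x"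
  using \<eta> by (simp add: W_def)

text \<open>Only the ball of radius \<open>sqrt (2 * \<gamma>)\<close> about the proposal mean is
  kept: its volume does not depend on \<open>x\<close>, and on it both the acceptance ratio and the
  proposal density are bounded below.\<close>

lemma acceptance_lower_bound:
  "\<exists>p>0. \<forall>x. max 4 (2 * K) \<le> norm x \<longrightarrow> ennreal p \<le> (\<integral>\<^sup>+ y. ennreal (acc x y * r x y) \<partial>lborel)"
proof -
  define c0 where "c0 = (4 * pi * \<gamma>) powr (- real DIM('a) / 2)"
  have c0: "0 < c0" using \<gamma> by (simp add: c0_def)
  define v where "v = unit_ball_vol (real DIM('a)) * sqrt (2 * \<gamma>) ^ DIM('a)"
  have v: "0 < v" using \<gamma> by (simp add: v_def)
  \<comment> \<open>One factor exp(-1/2) bounds the acceptance ratio, the other the Gaussian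
    exponent, which is at most 2\<gamma> / (4\<gamma>) in absolute value.\<close>
  define q where "q = exp (-1/2) * (c0 * exp (-1/2))"
  have q: "0 < q" using c0 by (simp add: q_def)
  have "ennreal (q * v) \<le> (\<integral>\<^sup>+ y. ennreal (acc x y * r x y) \<partial>lborel)" if x: "max 4 (2 * K) \<le> norm x" for x
  proof -
    define B where "B = cball (x - \<gamma> *\<^sub>R gU x) (sqrt (2 * \<gamma>))"
    have eB: "emeasure lborel B = ennreal v" unfolding B_def v_def using \<gamma> by (intro emeasure_cball) auto
    have "B \<in> sets lborel" by (simp add: B_def)
    then have "ennreal (q * v) = (\<integral>\<^sup>+y. ennreal q * indicator B y \<partial>lborel)"
      using q v by (subst nn_integral_cmult_indicator) (auto simp: eB ennreal_mult' less_imp_le)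
    also have "\<dots> \<le> (\<integral>\<^sup>+ y. ennreal (acc x y * r x y) \<partial>lborel)"
    proof (intro nn_integral_mono)
      fix y
      show "ennreal q * indicator B y \<le> ennreal (acc x y * r x y)"
      proof (cases "y \<in> B")
        case True
        then have "norm (y - x + \<gamma> *\<^sub>R gU x) \<le> sqrt (2 * \<gamma>)"
          by (simp add: B_def dist_norm norm_minus_commute algebra_simps)
        then have w: "(norm (y - x + \<gamma> *\<^sub>R gU x))\<^sup>2 \<le> 2 * \<gamma>"
          using \<gamma> power_mono[of _ "sqrt (2 * \<gamma>)" 2] by fastforce
        have "exp (-1/2) \<le> acc x y"
          unfolding acc_eq_exp using log_ratio_lower_bound[OF \<gamma> _ _ w] x by auto
        moreover have "c0 * exp (-1/2) \<le> r x y"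
          unfolding prop_dens_def c0_def[symmetric] using w \<gamma> c0 by (intro mult_left_mono) (auto simp: field_simps)
        ultimately have "q \<le> acc x y * r x y"
          unfolding q_def using c0 acc_pos[of x y] by (intro mult_mono) (auto simp: less_imp_le)
        then show ?thesis using True by (simp add: ennreal_leI)
      qed simp
    qed
    finally show ?thesis .
  qed
  then show ?thesis using q v by (intro exI[of _ "q * v"]) auto
qed

text \<open>The accepted part is at most the proposal's moment of \<open>W\<close>, the rejected
  part at most \<open>(1 - p) * W x\<close> far out. The gradient gain makes the former at most
  \<open>p / 2 * W x\<close>, so the total factor is \<open>1 - p / 2\<close>; inside a ball
  everything is bounded by the constant \<open>b\<close>.\<close>

lemma W_drift: "\<exists>lam b. 0 \<le> lam \<and> lam < 1 \<and> 0 \<le> b \<and> (\<forall>x. (\<integral>\<^sup>+y. ennreal (W y) \<partial>P x) \<le> ennreal (lam * W x + b))"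
proof -
  obtain p0 where p0: "p0 > 0" "\<And>x. max 4 (2 * K) \<le> norm x \<Longrightarrow> ennreal p0 \<le> (\<integral>\<^sup>+ y. ennreal (acc x y * r x y) \<partial>lborel)"
    using acceptance_lower_bound by blast
  define p where "p = min p0 1"
  have p: "0 < p" "p \<le> 1" "\<And>x. max 4 (2 * K) \<le> norm x \<Longrightarrow> ennreal p \<le> (\<integral>\<^sup>+ y. ennreal (acc x y * r x y) \<partial>lborel)"
    using p0 by (auto simp: p_def intro: order_trans[OF ennreal_leI[of _ p0]])
  obtain D where D: "0 \<le> D" "\<And>x. (\<integral>\<^sup>+y. ennreal (W y) * ennreal (r x y) \<partial>lborel) \<le> ennreal (D * exp (\<eta> * norm (x - \<gamma> *\<^sub>R gU x)))"
    using prop_dens_exp_moment[OF \<gamma>(1), of \<eta> gU] \<eta> unfolding W_def by auto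
  have split: "(\<integral>\<^sup>+y. ennreal (W y) \<partial>P x) \<le> ennreal (D * exp (\<eta> * norm (x - \<gamma> *\<^sub>R gU x)) + W x * \<kappa>)"
    if "rej x \<le> ennreal \<kappa>" "0 \<le> \<kappa>" for x \<kappa>
  proof -
    have "(\<integral>\<^sup>+y. ennreal (W y) \<partial>P x) = (\<integral>\<^sup>+ y. ennreal (W y) * ennreal (acc x y * r x y) \<partial>lborel) + ennreal (W x) * rej x"
      by (rule nn_integral_MALA) measurable
    also have "(\<integral>\<^sup>+ y. ennreal (W y) * ennreal (acc x y * r x y) \<partial>lborel) \<le> (\<integral>\<^sup>+ y. ennreal (W y) * ennreal (r x y) \<partial>lborel)"
      using acc_le_1 r_pos by (intro nn_integral_mono mult_left_mono ennreal_leI) (auto simp: less_imp_le mult_left_le_one_le acc_pos)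
    also have "\<dots> \<le> ennreal (D * exp (\<eta> * norm (x - \<gamma> *\<^sub>R gU x)))" by (rule D)
    also have "ennreal (W x) * rej x \<le> ennreal (W x * \<kappa>)"
      using that W_ge_1[of x] by (subst ennreal_mult) (auto intro: mult_left_mono)
    finally show ?thesis
      using D(1) that W_ge_1[of x] by (subst ennreal_plus) (auto simp: add_mono)
  qed
  \<comment> \<open>This gain multiplies the proposal moment by 1 / (2D/p + 1), which brings it
    below p/2 times the weight. The summand 1 keeps the logarithm meaningful when D = 0.\<close>
  define B where "B = ln (2 * D / p + 1) / (\<eta> * \<gamma>)"
  obtain R0 where R0: "R0 > 0" "\<And>x. R0 \<le> norm x \<Longrightarrow> norm (x - \<gamma> *\<^sub>R gU x) \<le> norm x - \<gamma> * B"
    using gradient_step_gain[of B] \<gamma> by fastforce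
  \<comment> \<open>The radius 4 and \<open>2 * K\<close> come from the acceptance bound,
    \<open>R0\<close> from the gradient gain.\<close>
  define R where "R = Max {R0, 4, 2 * K}"
  define b where "b = D * exp (\<eta> * (R + \<gamma> * (L * R))) + exp (\<eta> * (1 + R))"
  have b: "0 \<le> b" using D by (simp add: b_def)
  have "(\<integral>\<^sup>+y. ennreal (W y) \<partial>P x) \<le> ennreal ((1 - p / 2) * W x + b)" for x
  proof (cases "R \<le> norm x")
    case True
    have x: "R0 \<le> norm x" "max 4 (2 * K) \<le> norm x" using True by (auto simp: R_def)
    have "rej x \<le> ennreal (1 - p)"
    proof -
      have "ennreal p + rej x \<le> 1" using nn_integral_acc_plus_rej[of x] p(3)[OF x(2)] by (metis add_right_mono)
      then show ?thesis using p
        by (cases "rej x" rule: ennreal_cases) (auto simp: ennreal_plus[symmetric] ennreal_le_1 top_unique simp del: ennreal_plus intro: ennreal_leI)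
    qed
    then have "(\<integral>\<^sup>+y. ennreal (W y) \<partial>P x) \<le> ennreal (D * exp (\<eta> * norm (x - \<gamma> *\<^sub>R gU x)) + W x * (1 - p))"
      using p by (intro split) auto
    also have "\<dots> \<le> ennreal ((1 - p / 2) * W x + b)"
    proof (rule ennreal_leI)
      have q: "0 < 2 * D / p + 1" using D p by (simp add: add_nonneg_pos)
      have "\<eta> * norm (x - \<gamma> *\<^sub>R gU x) \<le> \<eta> * (norm x - \<gamma> * B)"
        using R0(2)[OF x(1)] \<eta> by (intro mult_left_mono) auto
      also have "\<dots> = \<eta> * norm x - ln (2 * D / p + 1)" using \<eta> \<gamma> by (simp add: B_def algebra_simps)
      finally have "exp (\<eta> * norm (x - \<gamma> *\<^sub>R gU x)) \<le> exp (\<eta> * norm x) / (2 * D / p + 1)"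
        using q by (metis exp_diff exp_le_cancel_iff exp_ln)
      also have "\<dots> \<le> W x / (2 * D / p + 1)" using W_ge_exp_norm q by (intro divide_right_mono) auto
      finally have "D * exp (\<eta> * norm (x - \<gamma> *\<^sub>R gU x)) \<le> D * (W x / (2 * D / p + 1))" using D by (intro mult_left_mono)
      also have "\<dots> = D / (2 * D / p + 1) * W x" by simp
      also have "\<dots> \<le> p / 2 * W x"
      proof (intro mult_right_mono)
        show "D / (2 * D / p + 1) \<le> p / 2" using q p D by (simp add: pos_divide_le_eq distrib_left)
      qed (use W_ge_1[of x] in simp)
      finally show "D * exp (\<eta> * norm (x - \<gamma> *\<^sub>R gU x)) + W x * (1 - p) \<le> (1 - p / 2) * W x + b"
        using b by (simp add: algebra_simps)
    qed
    finally show ?thesis .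
  next
    case False
    then have xR: "norm x \<le> R" by simp
    have "rej x \<le> ennreal 1" using nn_integral_acc_plus_rej[of x] by (metis add.commute ennreal_1 le_iff_add)
    then have "(\<integral>\<^sup>+y. ennreal (W y) \<partial>P x) \<le> ennreal (D * exp (\<eta> * norm (x - \<gamma> *\<^sub>R gU x)) + W x * 1)"
      by (intro split) auto
    also have "\<dots> \<le> ennreal ((1 - p / 2) * W x + b)"
    proof (rule ennreal_leI)
      have "norm (x - \<gamma> *\<^sub>R gU x) \<le> norm x + \<gamma> * norm (gU x)"
        using norm_triangle_ineq4[of x "\<gamma> *\<^sub>R gU x"] \<gamma> by simp
      also have "\<dots> \<le> R + \<gamma> * (L * R)"
        using norm_gU_le[of x] mult_left_mono[OF xR L(1)] \<gamma> xR by (intro add_mono mult_left_mono) auto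
      finally have "D * exp (\<eta> * norm (x - \<gamma> *\<^sub>R gU x)) \<le> D * exp (\<eta> * (R + \<gamma> * (L * R)))"
        using D \<eta> by (intro mult_left_mono) auto
      moreover have "W x \<le> exp (\<eta> * (1 + R))"
        using sqrt_one_plus_le[of x] xR \<eta> by (simp add: W_def)
      moreover have "0 \<le> (1 - p / 2) * W x" using p W_ge_1[of x] by simp
      ultimately show "D * exp (\<eta> * norm (x - \<gamma> *\<^sub>R gU x)) + W x * 1 \<le> (1 - p / 2) * W x + b"
        by (simp add: b_def)
    qed
    finally show ?thesis .
  qed
  then show ?thesis using p b by (intro exI[of _ "1 - p / 2"] exI[of _ b]) auto
qed

lemma W_integrable_pi: "integrable (pi_meas U) W"
proof -
  have "integrable lborel (\<lambda>x. W x * exp (- U x) / norm_const U)"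
    using exp_weight_integrable[of \<eta>] \<eta> by (simp add: W_def)
  then show ?thesis
    unfolding pi_meas_def using pi_dens_pos
    by (subst integrable_density) (auto simp: less_imp_le pi_dens_def mult.commute)
qed

lemma kernel_iter_MALA: "kernel_iter P k x = MALA_iter U gU \<gamma> k x"
  by (induction k) auto

theorem geometric_ergodicity:
  "\<exists>C \<rho>. C \<ge> 0 \<and> 0 \<le> \<rho> \<and> \<rho> < 1 \<and>
     (\<forall>x k. Vnorm (MALA_iter U gU \<gamma> k x) (pi_meas U) W \<le> ereal (C * \<rho> ^ k * W x))"
proof -
  obtain lam b where lb: "0 \<le> lam" "lam < 1" "0 \<le> b" "\<And>x. (\<integral>\<^sup>+y. ennreal (W y) \<partial>P x) \<le> ennreal (lam * W x + b)"
    using W_drift by blast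
  interpret drift_kernel P W lam b
    using lb W_ge_1 by unfold_locales (auto intro: MALA_measurable)
  \<comment> \<open>Solves \<open>(1 - lam) * S = 2 * b + 1\<close>, one unit above what Harris'
    theorem demands.\<close>
  define S where "S = (2 * b + 1) / (1 - lam)"
  have S: "2 * b < (1 - lam) * S" using lb by (simp add: S_def)
  have S0: "0 < S" using lb by (simp add: S_def)
  obtain \<epsilon> where \<epsilon>: "0 < \<epsilon>" "\<epsilon> < 1" "\<And>x A. norm x \<le> ln S / \<eta> \<Longrightarrow> A \<in> sets borel \<Longrightarrow>
     \<epsilon> * measure (uniform_measure lborel (cball 0 1)) A \<le> measure (P x) A"
    using minorization[of "ln S / \<eta>"] by blast
  \<comment> \<open>Level sets of \<open>W\<close> lie in balls, where the compactness minorization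
    is available.\<close>
  have level: "norm x \<le> ln S / \<eta>" if "W x \<le> S" for x
  proof -
    have "exp (\<eta> * norm x) \<le> S" using W_ge_exp_norm[of x] that by linarith
    then have "\<eta> * norm x \<le> ln S" using S0 by (simp add: ln_ge_iff)
    then show ?thesis using \<eta> by (simp add: pos_le_divide_eq mult.commute)
  qed
  have "unit_ball_vol (real DIM('a)) \<noteq> 0" using unit_ball_vol_pos[of "real DIM('a)"] by linarith
  then have "prob_space (uniform_measure lborel (cball (0::'a) 1))"
    by (intro prob_space_uniform_measure) (auto simp: emeasure_cball)
  then obtain C \<rho> where C: "0 \<le> C" "0 \<le> \<rho>" "\<rho> < 1"
    "\<And>f x k. f \<in> borel_measurable borel \<Longrightarrow> (\<And>x. \<bar>f x\<bar> \<le> W x) \<Longrightarrow>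
       \<bar>(\<integral>y. f y \<partial>kernel_iter P k x) - (\<integral>y. f y \<partial>pi_meas U)\<bar> \<le> C * \<rho> ^ k * W x"
    using harris[OF S \<epsilon>(1,2), of "uniform_measure lborel (cball 0 1)" "pi_meas U"] \<epsilon>(3) level
      pi_meas_invariant W_integrable_pi prob_space_pi_meas by (auto simp: admissible_def)
  have "Vnorm (MALA_iter U gU \<gamma> k x) (pi_meas U) W \<le> ereal (C * \<rho> ^ k * W x)" for x k
    unfolding Vnorm_def kernel_iter_MALA[symmetric] by (intro SUP_least) (auto intro!: C(4))
  then show ?thesis using C by blast
qed

end

theorem theorem4:
  fixes U :: "'a::euclidean_space \<Rightarrow> real"
    and gU :: "'a \<Rightarrow> 'a"
    and HU :: "'a \<Rightarrow> ('a \<Rightarrow>\<^sub>L 'a)"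
    and \<beta> L m\<^sub>\<beta> L\<^sub>\<beta> K\<^sub>\<beta> :: real
  assumes beta: "0 \<le> \<beta>" "\<beta> < 1"
    and grad: "\<And>x. (U has_derivative (\<lambda>h. gU x \<bullet> h)) (at x)"
    and hess: "\<And>x. (gU has_derivative blinfun_apply (HU x)) (at x)"
    and hess_cont: "continuous_on UNIV HU"
    and grad0: "gU 0 = 0"
    and L: "L \<ge> 0" "\<And>x. norm (HU x) \<le> L"
    and mb: "m\<^sub>\<beta> > 0" and Lb: "L\<^sub>\<beta> \<ge> 0" and Kb: "K\<^sub>\<beta> \<ge> 0"
    and tail: "\<And>x y. norm x \<ge> K\<^sub>\<beta> \<Longrightarrow> norm y = 1 \<Longrightarrow>
          L\<^sub>\<beta> / (1 + rpow (norm x) (3 * \<beta> / 4)) \<ge> HU x y \<bullet> y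
        \<and> HU x y \<bullet> y \<ge> m\<^sub>\<beta> / (1 + rpow (norm x) \<beta>)"
  shows "\<exists>\<Gamma>>0. \<forall>\<gamma>. 0 < \<gamma> \<and> \<gamma> \<le> \<Gamma> \<longrightarrow>
           (\<exists>C \<rho>. C \<ge> 0 \<and> 0 \<le> \<rho> \<and> \<rho> < 1 \<and>
              (\<forall>x k. Vnorm (MALA_iter U gU \<gamma> k x) (pi_meas U)
                        (\<lambda>z. exp ((m\<^sub>\<beta> / 2^5) * sqrt (1 + (norm z)\<^sup>2)))
                     \<le> ereal (C * \<rho> ^ k * exp ((m\<^sub>\<beta> / 2^5) * sqrt (1 + (norm x)\<^sup>2)))))"
proof -
  \<comment> \<open>The entries are the step-size conditions of \<open>mala_tail\<close>; the added
    ones avoid division by zero when \<open>L\<close> or \<open>L\<^sub>\<beta>\<close>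
    vanishes.\<close>
  define \<Gamma> where "\<Gamma> = Min {1/4, 1 / (4 * (L + 1)), m\<^sub>\<beta> / (4 * (L\<^sub>\<beta>\<^sup>2 + 1))}"
  have "0 < \<Gamma>" using L mb by (simp add: \<Gamma>_def add_nonneg_pos)
  moreover have "\<exists>C \<rho>. C \<ge> 0 \<and> 0 \<le> \<rho> \<and> \<rho> < 1 \<and>
              (\<forall>x k. Vnorm (MALA_iter U gU \<gamma> k x) (pi_meas U)
                        (\<lambda>z. exp ((m\<^sub>\<beta> / 2^5) * sqrt (1 + (norm z)\<^sup>2)))
                     \<le> ereal (C * \<rho> ^ k * exp ((m\<^sub>\<beta> / 2^5) * sqrt (1 + (norm x)\<^sup>2))))"
    if \<gamma>: "0 < \<gamma>" "\<gamma> \<le> \<Gamma>" for \<gamma>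
  proof -
    have "\<gamma> \<le> 1/4" "\<gamma> \<le> 1 / (4 * (L + 1))" "\<gamma> \<le> m\<^sub>\<beta> / (4 * (L\<^sub>\<beta>\<^sup>2 + 1))"
      using \<gamma> by (auto simp: \<Gamma>_def)
    moreover have "0 < 4 * (L + 1)" "0 < 4 * (L\<^sub>\<beta>\<^sup>2 + 1)" using L by (auto simp: add_nonneg_pos)
    ultimately have "\<gamma> \<le> 1/4" "\<gamma> * (4 * (L + 1)) \<le> 1" "\<gamma> * (4 * (L\<^sub>\<beta>\<^sup>2 + 1)) \<le> m\<^sub>\<beta>"
      by (simp_all add: pos_le_divide_eq)
    then have g: "\<gamma> \<le> 1/4" "\<gamma> * L \<le> 1/4" "\<gamma> * L\<^sub>\<beta>\<^sup>2 \<le> m\<^sub>\<beta> / 4"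
      using \<gamma> by (simp_all add: algebra_simps)
    interpret mala_tail U gU HU \<beta> L m\<^sub>\<beta> L\<^sub>\<beta> K\<^sub>\<beta> \<gamma> "m\<^sub>\<beta> / 2^5"
      using assms \<gamma> g by unfold_locales auto
    show ?thesis using geometric_ergodicity unfolding W_def[abs_def] .
  qed
  ultimately show ?thesis by blast
qed

end
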